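(* Let $G=(V,E,w)$ be a connected hypergraph with $V=\{v_1,\dots,v_{n+m}\}$ and let $1\le p<3$. Let $a=(0,\dots,0,a_1,\dots,a_m)$ (first $n$ components zero) and $h$ satisfy $$a\in W^{1,2}_{\mathrm{loc}}(0,\infty;\mathbb{R}^V),\quad h\in L^2_{\mathrm{loc}}(0,\infty;\mathbb{R}^V),\quad a',h'\in L^1(0,\infty;\mathbb{R}^V),$$ and put $a_\infty=\lim_{t\to\infty}a(t)$, $h_\infty=\lim_{t\to\infty}h(t)$. Suppose moreover that $$a'\in L^2(0,\infty;\mathbb{R}^V),\qquad h_\infty\in R(\partial\varphi+\partial I_{K_{a_\infty}}),$$ $$a-a_\infty\in L^1(0,\infty;\mathbb{R}^V),\qquad h-h_\infty\in L^1(0,\infty;\mathbb{R}^V)\cap L^2(0,\infty;\mathbb{R}^V).$$ Let $x_0\in K_a(0)$ and let $x$ be the unique global solution to $$x'(t)+\partial\varphi(x(t))+\partial I_{K_a(t)}(x(t))\ni h(t)\quad(t\in[0,\infty)),\qquad x(0)=x_0 .$$ Then the limit $x_\infty=\lim_{t\to\infty}x(t)$ exists (uniquely determined) and satisfies $$\partial\varphi(x_\infty)+\partial I_{K_{a_\infty}}(x_\infty)\ni h_\infty .$$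
   Context: Hypergraph: $n,m\ge 1$ are integers, $V=\{v_1,\dots,v_n,v_{n+1},\dots,v_{n+m}\}$ is a finite set with $n+m$ elements, $E\subset 2^V$ is a family of subsets of $V$ each having at least two elements, and $w:E\to(0,\infty)$. The triplet $G=(V,E,w)$ is called a hypergraph. $G$ is connected if for all $u,v\in V$ there exist $u_1,\dots,u_{N-1}\in V$ and $e_1,\dots,e_N\in E$ with $u_{j-1},u_j\in e_j$ for $j=1,\dots,N$, where $u_0=u$, $u_N=v$. $\mathbb{R}^V$ is the set of maps $x:V\to\mathbb{R}$, identified with $\mathbb{R}^{n+m}$ via $x_i=x(v_i)$, with standard inner product $x\cdot y$ and Euclidean norm $\|x\|$. Energy: $f_e(x)=\max_{u,v\in e}(x(u)-x(v))$ for $e\in E$, and $\varphi(x)=\frac1p\sum_{e\in E}w(e)(f_e(x))^p$. Subdifferential: for a proper lower semicontinuous convex $\psi:\mathbb{R}^V\to(-\infty,+\infty]$, $\partial\psi(x)=\{\eta\in\mathbb{R}^V:\ \eta\cdot(z-x)\le\psi(z)-\psi(x)\ \forall z\in\mathbb{R}^V\}$ if $\psi(x)<\infty$, and $\partial\psi(x)=\varnothing$ otherwise. Constraint: $K_a(t)=\{x\in\mathbb{R}^V:\ x=(x_1,\dots,x_n,a_1(t),\dots,a_m(t)),\ x_i\in\mathbb{R}\ (i=1,\dots,n)\}$, and $I_{K_a(t)}$ is its indicator function ($0$ on $K_a(t)$, $+\infty$ elsewhere). For a constant vector such as $a_\infty=(0,\dots,0,a_{\infty1},\dots,a_{\infty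 m})$, $K_{a_\infty}$ is the corresponding time-independent set. $R(\partial\varphi+\partial I_{K_{a_\infty}})=\bigcup_{y\in\mathbb{R}^V}\big(\partial\varphi(y)+\partial I_{K_{a_\infty}}(y)\big)$ denotes the range. Function spaces: $W^{1,2}(0,T;\mathbb{R}^V)$ is the set of functions that belong to $L^2(0,T;\mathbb{R}^V)$ together with their derivative; elements are identified with their (absolutely) continuous representatives on $[0,T]$. $W^{1,2}_{\mathrm{loc}}(0,\infty;\mathbb{R}^V)$ and $L^2_{\mathrm{loc}}(0,\infty;\mathbb{R}^V)$ denote functions on $[0,\infty)$ whose restriction to $(0,T)$ belongs to $W^{1,2}(0,T;\mathbb{R}^V)$, respectively $L^2(0,T;\mathbb{R}^V)$, for every $T\in(0,\infty)$; $h'$ is the (weak) derivative of $h$, and $h$ is identified with its continuous representative. Since $a',h'\in L^1$, the limits $a_\infty,h_\infty$ exist. A global solution is a function $x\in W^{1,2}_{\mathrm{loc}}(0,\infty;\mathbb{R}^V)$ with $x(0)=x_0$ for which the inclusion holds for a.e. $t$, i.e. there are $\eta(t)\in\partial\varphi(x(t))$ and $\xi(t)\in\partial I_{K_a(t)}(x(t))$ with $x'(t)+\eta(t)+\xi(t)=h(t)$ for a.e. $t>0$. (It exists and is unique for the data considered.) *)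

theory Defs
  imports "HOL-Analysis.Analysis" "HOL-Library.Set_Algebras"
begin

text \<open>
  The vertex set is a finite type, so a vertex function \<open>V \<rightarrow> \<real>\<close> is a vector in \<open>real ^ 'v\<close>.
  Where the splitting \<open>V = {v\<^sub>1,\<dots>,v\<^sub>n} \<union> {v\<^bsub>n+1\<^esub>,\<dots>,v\<^bsub>n+m\<^esub>}\<close> matters, the vertex type is
  \<open>'n + 'm\<close>: \<open>Inl i\<close> are the first \<open>n = CARD('n)\<close> vertices and \<open>Inr j\<close> the last \<open>m = CARD('m)\<close>
  ones, where the value is prescribed. Types being nonempty, \<open>n, m \<ge> 1\<close>.
\<close>

definition hypergraph :: "('v::finite) set set \<Rightarrow> ('v set \<Rightarrow> real) \<Rightarrow> bool" where
  "hypergraph E w \<longleftrightarrow> (\<forall>e\<in>E. card e \<ge> 2) \<and> (\<forall>e\<in>E. w e > 0)"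

definition connected_hypergraph :: "('v::finite) set set \<Rightarrow> bool" where
  "connected_hypergraph E \<longleftrightarrow>
     (\<forall>u v. \<exists>(N::nat) (us :: nat \<Rightarrow> 'v) (es :: nat \<Rightarrow> 'v set).
        N \<ge> 1 \<and> us 0 = u \<and> us N = v \<and>
        (\<forall>j\<in>{1..N}. es j \<in> E \<and> us (j - 1) \<in> es j \<and> us j \<in> es j))"

definition edge_diff :: "'v set \<Rightarrow> real ^ ('v::finite) \<Rightarrow> real" where
  "edge_diff e x = Max {x $ u - x $ v | u v. u \<in> e \<and> v \<in> e}"

definition energy ::
  "real \<Rightarrow> 'v set set \<Rightarrow> ('v set \<Rightarrow> real) \<Rightarrow> real ^ ('v::finite) \<Rightarrow> real" where
  "energy p E w x = (1 / p) * (\<Sum>e\<in>E. w e * edge_diff e x powr p)"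

definition subdifferential :: "('a::real_inner \<Rightarrow> ereal) \<Rightarrow> 'a \<Rightarrow> 'a set" where
  "subdifferential \<psi> x =
     (if \<psi> x < \<infinity> then {\<eta>. \<forall>z. ereal (\<eta> \<bullet> (z - x)) \<le> \<psi> z - \<psi> x} else {})"

definition indicator_fun :: "'a set \<Rightarrow> 'a \<Rightarrow> ereal" where
  "indicator_fun K x = (if x \<in> K then 0 else \<infinity>)"

text \<open>\<open>K\<^sub>a(t)\<close> is \<open>constraint_set (a t)\<close>; only the components \<open>c $ Inr j\<close> of \<open>c\<close> are used.\<close>

definition constraint_set :: "real ^ ('n::finite + 'm::finite) \<Rightarrow> (real ^ ('n + 'm)) set" where
  "constraint_set c = {x. \<forall>j. x $ Inr j = c $ Inr j}"

definition dphi ::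
  "real \<Rightarrow> 'v set set \<Rightarrow> ('v set \<Rightarrow> real) \<Rightarrow> real ^ ('v::finite) \<Rightarrow> (real ^ 'v) set" where
  "dphi p E w = subdifferential (\<lambda>x. ereal (energy p E w x))"

definition dI :: "real ^ ('n::finite + 'm::finite) \<Rightarrow> real ^ ('n + 'm) \<Rightarrow> (real ^ ('n + 'm)) set" where
  "dI c = subdifferential (indicator_fun (constraint_set c))"

text \<open>
  Function spaces. \<open>L\<^sup>1(S)\<close> is the library's \<open>absolutely_integrable_on S\<close>. Weak derivatives are
  taken with respect to compactly supported \<open>C\<^sup>1\<close> test functions; membership in \<open>W\<^bsup>1,2\<^esup>\<close> on
  \<open>[0,\<infinity>)\<close> includes that the function is the continuous representative of its class.
\<close>

definition L2_on :: "real set \<Rightarrow> (real \<Rightarrow> 'a::euclidean_space) \<Rightarrow> bool" where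
  "L2_on S f \<longleftrightarrow> f \<in> borel_measurable (lebesgue_on S) \<and>
     (\<lambda>t. (norm (f t))\<^sup>2) absolutely_integrable_on S"

definition test_function_on :: "real set \<Rightarrow> (real \<Rightarrow> real) \<Rightarrow> bool" where
  "test_function_on S \<theta> \<longleftrightarrow> \<theta> C1_differentiable_on UNIV \<and>
     compact (closure {t. \<theta> t \<noteq> 0}) \<and> closure {t. \<theta> t \<noteq> 0} \<subseteq> S"

definition weak_derivative_on ::
  "real set \<Rightarrow> (real \<Rightarrow> 'a::euclidean_space) \<Rightarrow> (real \<Rightarrow> 'a) \<Rightarrow> bool" where
  "weak_derivative_on S f g \<longleftrightarrow>
     (\<forall>C. compact C \<and> C \<subseteq> S \<longrightarrow> f absolutely_integrable_on C \<and> g absolutely_integrable_on C) \<and>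
     (\<forall>\<theta>. test_function_on S \<theta> \<longrightarrow>
        (LINT t:S|lebesgue. deriv \<theta> t *\<^sub>R f t) = - (LINT t:S|lebesgue. \<theta> t *\<^sub>R g t))"

definition W12_on :: "real set \<Rightarrow> (real \<Rightarrow> 'a::euclidean_space) \<Rightarrow> bool" where
  "W12_on S f \<longleftrightarrow> L2_on S f \<and> (\<exists>g. L2_on S g \<and> weak_derivative_on S f g)"

definition L2_loc :: "(real \<Rightarrow> 'a::euclidean_space) \<Rightarrow> bool" where
  "L2_loc f \<longleftrightarrow> (\<forall>T>0. L2_on {0<..<T} f)"

definition W12_loc :: "(real \<Rightarrow> 'a::euclidean_space) \<Rightarrow> bool" where
  "W12_loc f \<longleftrightarrow> continuous_on {0..} f \<and> (\<forall>T>0. W12_on {0<..<T} f)"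

definition global_solution ::
  "real \<Rightarrow> ('n::finite + 'm::finite) set set \<Rightarrow> (('n + 'm) set \<Rightarrow> real) \<Rightarrow>
   (real \<Rightarrow> real ^ ('n + 'm)) \<Rightarrow> (real \<Rightarrow> real ^ ('n + 'm)) \<Rightarrow> real ^ ('n + 'm) \<Rightarrow>
   (real \<Rightarrow> real ^ ('n + 'm)) \<Rightarrow> bool" where
  "global_solution p E w a h x0 x \<longleftrightarrow>
     W12_loc x \<and> x 0 = x0 \<and>
     (\<exists>x'. weak_derivative_on {0<..} x x' \<and>
        (AE t in lebesgue_on {0<..}.
           \<exists>\<eta>\<in>dphi p E w (x t). \<exists>\<xi>\<in>dI (a t) (x t). x' t + \<eta> + \<xi> = h t))"

end

theory Submission
  imports Defs
begin

text \<open>Let \<open>P = free_part\<close> be the projection onto the components that are not prescribed. An equilibrium is a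
point \<open>y\<close> with \<open>y = P y + a_inf\<close> for which some \<open>\<zeta> \<in> \<partial>\<phi>(y)\<close> satisfies \<open>P \<zeta> = P h_inf\<close>, and \<open>z = P (x - y)\<close>
agrees with \<open>x - y\<close> up to \<open>a - a_inf\<close>. Testing the equation with \<open>z\<close> and using the subgradient inequality
for \<open>\<eta> \<in> \<partial>\<phi>(x)\<close> gives, for almost every \<open>t\<close>,

  \<open>1/2 d/dt \<parallel>z\<parallel>\<^sup>2 + (\<phi>(x) - \<phi>(y) - h_inf \<bullet> z) \<le> \<parallel>h - h_inf\<parallel> \<parallel>z\<parallel> + \<parallel>\<eta>\<parallel> \<parallel>a - a_inf\<parallel>\<close>.

As \<open>p \<le> 3\<close>, subgradients grow at most quadratically (\<open>dphi_quadratic_growth\<close>), so the right-hand side is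
at most \<open>k (1 + \<parallel>z\<parallel>\<^sup>2)\<close> with an integrable function \<open>k\<close>. The bracket is bounded below by
\<open>- \<parallel>\<zeta>\<parallel> \<parallel>a - a_inf\<parallel>\<close>, again integrable. Consequently (\<open>perturbed_dissipation\<close>) \<open>x\<close> is bounded, \<open>\<parallel>z\<parallel>\<close>
converges, and the bracket tends to \<open>0\<close> along some times tending to infinity.

Any limit point \<open>x\<^sub>*\<close> of \<open>x\<close> along these times satisfies \<open>\<phi>(x\<^sub>*) - \<phi>(y) = h_inf \<bullet> P (x\<^sub>* - y) = \<zeta> \<bullet> (x\<^sub>* - y)\<close>.
Hence the subgradient \<open>\<zeta>\<close> at \<open>y\<close> is a subgradient at \<open>x\<^sub>*\<close> as well, and \<open>x\<^sub>*\<close> is an equilibrium. The first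
step with \<open>x\<^sub>*\<close> in place of \<open>y\<close> shows that \<open>\<parallel>P (x - x\<^sub>*)\<parallel>\<close> converges, necessarily to \<open>0\<close>, and
\<open>a \<rightarrow> a_inf\<close> takes care of the prescribed components (\<open>converges_to_equilibrium\<close>).

Two facts on weak derivatives make the differential inequality rigorous: a continuous function is the
indefinite integral of its weak derivative (\<open>weak_derivative_has_integral\<close>), and \<open>\<parallel>z\<parallel>\<^sup>2\<close> is then the
indefinite integral of \<open>2 z \<bullet> z'\<close> (\<open>norm_square_has_integral\<close>).\<close>

section \<open>Weak derivatives and indefinite integrals\<close>

lemma absolutely_integrable_continuous_bilinear:
  fixes \<phi> :: "real \<Rightarrow> 'b::euclidean_space" and g :: "real \<Rightarrow> 'a::euclidean_space"
    and B :: "'b \<Rightarrow> 'a \<Rightarrow> 'c::euclidean_space"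
  assumes "bilinear B" "continuous_on {a..b} \<phi>" "g absolutely_integrable_on {a..b}"
  shows "(\<lambda>t. B (\<phi> t) (g t)) absolutely_integrable_on {a..b}"
proof (rule absolutely_integrable_bounded_measurable_product[where h = B and f = \<phi> and g = g])
  show "bilinear B" "g absolutely_integrable_on {a..b}" by fact+
  show "\<phi> \<in> borel_measurable (lebesgue_on {a..b})"
    using assms(2) by (intro continuous_imp_measurable_on_sets_lebesgue) auto
  show "bounded (\<phi> ` {a..b})"
    using assms(2) by (intro compact_imp_bounded compact_continuous_image) auto
qed auto

lemma bilinear_scaleR: "bilinear (\<lambda>(c::real) (v::'a::euclidean_space). c *\<^sub>R v)"
  by (simp add: bilinear_conv_bounded_bilinear bounded_bilinear_scaleR)

lemma bilinear_inner: "bilinear (\<lambda>(u::'a::euclidean_space) v. u \<bullet> v)"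
  by (simp add: bilinear_conv_bounded_bilinear bounded_bilinear_inner)

text \<open>A triangular bump of unit mass on \<open>[0, 1]\<close>, and its primitive vanishing on the negative half-line,
a \<open>C\<^sup>1\<close> step from \<open>0\<close> to \<open>1\<close>. Expressing both through positive parts avoids case distinctions when
differentiating.\<close>

definition tent :: "real \<Rightarrow> real" where
  "tent r = 4 * (max 0 r - 2 * max 0 (r - 1/2) + max 0 (r - 1))"

definition ramp :: "real \<Rightarrow> real" where
  "ramp r = 2 * ((max 0 r)\<^sup>2 - 2 * (max 0 (r - 1/2))\<^sup>2 + (max 0 (r - 1))\<^sup>2)"

lemma has_real_derivative_max0_squared:
  "((\<lambda>r::real. (max 0 r)\<^sup>2) has_real_derivative 2 * max 0 r) (at r)"
proof -
  consider "r < 0" | "r > 0" | "r = 0" by linarith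
  then show ?thesis
  proof cases
    case 1
    have "((\<lambda>r::real. 0) has_real_derivative 0) (at r)" by simp
    then have "((\<lambda>r::real. (max 0 r)\<^sup>2) has_real_derivative 0) (at r)"
      by (rule has_field_derivative_transform_within_open[where S="{..<0}"]) (use 1 in auto)
    then show ?thesis using 1 by simp
  next
    case 2
    have "((\<lambda>r::real. r\<^sup>2) has_real_derivative 2 * r) (at r)"
      by (auto intro!: derivative_eq_intros)
    then have "((\<lambda>r::real. (max 0 r)\<^sup>2) has_real_derivative 2 * r) (at r)"
      by (rule has_field_derivative_transform_within_open[where S="{0<..}"]) (use 2 in auto)
    then show ?thesis using 2 by simp
  next
    case 3
    have "((\<lambda>h::real. (max 0 h)\<^sup>2 / h) \<longlongrightarrow> 0) (at 0)"
    proof (rule tendsto_0_le[where K=1])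
      show "((\<lambda>h::real. h) \<longlongrightarrow> 0) (at 0)" by (rule tendsto_ident_at)
      show "\<forall>\<^sub>F h in at (0::real). norm ((max 0 h)\<^sup>2 / h) \<le> norm h * 1"
        by (rule always_eventually) (auto simp: max_def power2_eq_square)
    qed
    then show ?thesis using 3 by (simp add: DERIV_def)
  qed
qed

lemma has_real_derivative_ramp: "(ramp has_real_derivative tent r) (at r)"
proof -
  have shift: "((\<lambda>r::real. (max 0 (r - c))\<^sup>2) has_real_derivative 2 * max 0 (r - c)) (at r)" for c
    by (rule DERIV_chain2[where Db = 1 and s = UNIV, OF has_real_derivative_max0_squared, simplified])
       (auto intro!: derivative_eq_intros)
  show ?thesis
    unfolding ramp_def[abs_def] tent_def
    by (rule derivative_eq_intros has_real_derivative_max0_squared shift refl)+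
       (simp add: algebra_simps)
qed

lemma has_real_derivative_scaled_ramp:
  "((\<lambda>\<tau>. ramp (k * (\<tau> - r))) has_real_derivative k * tent (k * (\<tau> - r))) (at \<tau>)"
proof -
  have "((\<lambda>\<tau>. k * (\<tau> - r)) has_real_derivative k) (at \<tau>)"
    by (auto intro!: derivative_eq_intros)
  from DERIV_chain2[OF has_real_derivative_ramp this] show ?thesis
    by (simp add: mult.commute)
qed

lemma continuous_on_tent [continuous_intros]:
  "continuous_on S f \<Longrightarrow> continuous_on S (\<lambda>x. tent (f x))"
  unfolding tent_def by (intro continuous_intros)

lemma continuous_on_ramp [continuous_intros]:
  "continuous_on S f \<Longrightarrow> continuous_on S (\<lambda>x. ramp (f x))"
  unfolding ramp_def by (intro continuous_intros)

lemma tent_nonneg: "0 \<le> tent r"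
  unfolding tent_def by (auto simp: max_def)

lemma tent_eq_0: "r \<le> 0 \<or> 1 \<le> r \<Longrightarrow> tent r = 0"
  unfolding tent_def by (auto simp: max_def field_simps)

lemma ramp_eq_0: "r \<le> 0 \<Longrightarrow> ramp r = 0"
  unfolding ramp_def by (auto simp: max_def)

lemma ramp_eq_1: "1 \<le> r \<Longrightarrow> ramp r = 1"
  unfolding ramp_def by (auto simp: max_def power2_eq_square field_simps)

lemma ramp_mono: "r \<le> s \<Longrightarrow> ramp r \<le> ramp s"
  using DERIV_nonneg_imp_nondecreasing[of r s ramp] has_real_derivative_ramp tent_nonneg by blast

lemma ramp_bounds: "0 \<le> ramp r" "ramp r \<le> 1"
  using ramp_mono[of "min r 0" r] ramp_mono[of r "max r 1"] ramp_eq_0[of "min r 0"]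
    ramp_eq_1[of "max r 1"] by auto

text \<open>The scaled bumps \<open>k * tent (k * (\<tau> - r))\<close> have unit mass and live on \<open>[r, r + 1/k]\<close>, so they pick out
the value \<open>f r\<close> in the limit \<open>k \<rightarrow> \<infinity>\<close>.\<close>

lemma tent_average_tendsto:
  fixes f :: "real \<Rightarrow> 'a::euclidean_space"
  assumes cont: "continuous_on {c..d} f" and r: "c \<le> r" "r + 1 \<le> d"
  shows "(\<lambda>n. integral {c..d} (\<lambda>\<tau>. (real (Suc n) * tent (real (Suc n) * (\<tau> - r))) *\<^sub>R f \<tau>))
           \<longlonglongrightarrow> f r"
proof (rule LIMSEQ_I)
  fix e :: real assume "0 < e"
  then obtain \<delta> where \<delta>: "\<delta> > 0" "\<And>\<tau>. \<tau> \<in> {c..d} \<Longrightarrow> dist \<tau> r < \<delta> \<Longrightarrow> dist (f \<tau>) (f r) < e / 2"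
    using cont[unfolded continuous_on_iff, rule_format, of r "e / 2"] r by auto
  obtain n0 where n0: "inverse (real (Suc n0)) < \<delta>"
    using reals_Archimedean[OF \<delta>(1)] by auto
  show "\<exists>no. \<forall>n\<ge>no. norm (integral {c..d} (\<lambda>\<tau>. (real (Suc n) * tent (real (Suc n) * (\<tau> - r))) *\<^sub>R f \<tau>) - f r) < e"
  proof (intro exI allI impI)
    fix n assume "n \<ge> n0"
    define k where "k = real (Suc n)"
    have k: "k \<ge> 1" by (simp add: k_def)
    have "inverse k \<le> inverse (real (Suc n0))"
      using \<open>n \<ge> n0\<close> by (simp add: k_def field_simps)
    with n0 have k\<delta>: "inverse k < \<delta>" by simp
    define \<rho> where "\<rho> = (\<lambda>\<tau>. k * tent (k * (\<tau> - r)))"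
    have deriv: "((\<lambda>\<tau>. ramp (k * (\<tau> - r))) has_vector_derivative \<rho> \<tau>) (at \<tau> within {c..d})" for \<tau>
      unfolding \<rho>_def has_real_derivative_iff_has_vector_derivative[symmetric]
      by (rule has_field_derivative_at_within)
         (rule has_real_derivative_scaled_ramp)
    have "(\<rho> has_integral (ramp (k * (d - r)) - ramp (k * (c - r)))) {c..d}"
      using fundamental_theorem_of_calculus[of c d "\<lambda>\<tau>. ramp (k * (\<tau> - r))" \<rho>] deriv r by auto
    moreover have "ramp (k * (d - r)) = 1"
      using k r mult_mono[of 1 k 1 "d - r"] by (intro ramp_eq_1) auto
    moreover have "ramp (k * (c - r)) = 0"
      using k r by (intro ramp_eq_0) (simp add: mult_le_0_iff)
    ultimately have mass: "(\<rho> has_integral 1) {c..d}" by simp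
    have int: "(\<lambda>\<tau>. \<rho> \<tau> *\<^sub>R f \<tau>) integrable_on {c..d}"
      unfolding \<rho>_def by (intro integrable_continuous_real continuous_intros cont)
    have massf: "((\<lambda>\<tau>. \<rho> \<tau> *\<^sub>R f r) has_integral f r) {c..d}"
      using has_integral_scaleR_left[OF mass, of "f r"] by simp
    have "integral {c..d} (\<lambda>\<tau>. \<rho> \<tau> *\<^sub>R f \<tau>) - f r
        = integral {c..d} (\<lambda>\<tau>. \<rho> \<tau> *\<^sub>R f \<tau>) - integral {c..d} (\<lambda>\<tau>. \<rho> \<tau> *\<^sub>R f r)"
      using massf by (simp add: integral_unique)
    also have "\<dots> = integral {c..d} (\<lambda>\<tau>. \<rho> \<tau> *\<^sub>R f \<tau> - \<rho> \<tau> *\<^sub>R f r)"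
      using int massf by (intro integral_diff[symmetric]) auto
    also have "norm \<dots> \<le> integral {c..d} (\<lambda>\<tau>. \<rho> \<tau> * (e / 2))"
    proof (rule integral_norm_bound_integral)
      show "(\<lambda>\<tau>. \<rho> \<tau> *\<^sub>R f \<tau> - \<rho> \<tau> *\<^sub>R f r) integrable_on {c..d}"
        using int massf by (intro integrable_diff) auto
      show "(\<lambda>\<tau>. \<rho> \<tau> * (e / 2)) integrable_on {c..d}"
        using mass by (intro integrable_on_mult_left) auto
      fix \<tau> assume \<tau>: "\<tau> \<in> {c..d}"
      have \<rho>: "\<rho> \<tau> \<ge> 0" using k by (simp add: \<rho>_def tent_nonneg)
      show "norm (\<rho> \<tau> *\<^sub>R f \<tau> - \<rho> \<tau> *\<^sub>R f r) \<le> \<rho> \<tau> * (e / 2)"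
      proof (cases "\<tau> \<le> r \<or> 1 \<le> k * (\<tau> - r)")
        case True
        then have "\<rho> \<tau> = 0"
          unfolding \<rho>_def using k by (subst tent_eq_0) (auto simp: mult_le_0_iff)
        then show ?thesis by simp
      next
        case False
        then have "dist \<tau> r < inverse k" using k by (auto simp: dist_real_def field_simps)
        then have "norm (f \<tau> - f r) \<le> e / 2"
          using \<delta>(2)[OF \<tau>] k\<delta> by (simp add: dist_norm)
        then show ?thesis using \<rho>
          by (simp add: scaleR_diff_right[symmetric] mult_left_mono del: times_divide_eq_right)
      qed
    qed
    also have "\<dots> = e / 2" using integral_unique[OF has_integral_mult_left[OF mass, of "e / 2"]] by (simp only: mult_1)
    also have "\<dots> < e" using \<open>0 < e\<close> by simp
    finally show "norm (integral {c..d} (\<lambda>\<tau>. (real (Suc n) * tent (real (Suc n) * (\<tau> - r))) *\<^sub>R f \<tau>) - f r) < e"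
      by (simp add: \<rho>_def k_def)
  qed
qed

lemma set_lebesgue_integral_eq_integral_support:
  fixes f :: "real \<Rightarrow> 'a::euclidean_space"
  assumes "C \<subseteq> S" "f absolutely_integrable_on C" "\<And>t. t \<in> S - C \<Longrightarrow> f t = 0"
  shows "(LINT t:S|lebesgue. f t) = integral C f"
proof -
  have "(LINT t:S|lebesgue. f t) = (LINT t:C|lebesgue. f t)"
    unfolding set_lebesgue_integral_def using assms(1,3)
    by (intro Bochner_Integration.integral_cong) (auto simp: indicator_def)
  then show ?thesis using set_lebesgue_integral_eq_integral(2)[OF assms(2)] by simp
qed

text \<open>The fundamental theorem of calculus for weak derivatives. The definition of the weak derivative is
tested with a difference of two steps, which approximates the indicator function of \<open>(s, t]\<close>; the
left-hand side then tends to \<open>f s - f t\<close> because the derivative of the test function is a difference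
of two bumps, and the right-hand side to \<open>- \<integral> g\<close> over \<open>(s, t]\<close> by dominated convergence.\<close>

lemma weak_derivative_has_integral:
  fixes f g :: "real \<Rightarrow> 'a::euclidean_space"
  assumes wd: "weak_derivative_on {0<..} f g" and cont: "continuous_on {0<..} f"
    and s: "0 < s" "s \<le> t"
  shows "(g has_integral (f t - f s)) {s..t}"
proof -
  \<comment> \<open>contains the supports of all the test functions below\<close>
  define C where "C = {s..t+1}"
  have C: "compact C" "C \<subseteq> {0<..}" using s by (auto simp: C_def)
  have contC: "continuous_on C f" using cont C(2) by (rule continuous_on_subset)
  have gC: "g absolutely_integrable_on C"
    using wd C by (auto simp: weak_derivative_on_def)
  define \<theta> where "\<theta> = (\<lambda>n \<tau>. ramp (real (Suc n) * (\<tau> - s)) - ramp (real (Suc n) * (\<tau> - t)))"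
  define \<theta>' where "\<theta>' = (\<lambda>n \<tau>. real (Suc n) * tent (real (Suc n) * (\<tau> - s))
                                - real (Suc n) * tent (real (Suc n) * (\<tau> - t)))"
  have der: "(\<theta> n has_real_derivative \<theta>' n \<tau>) (at \<tau>)" for n \<tau>
    unfolding \<theta>_def \<theta>'_def
    by (intro DERIV_diff has_real_derivative_scaled_ramp)
  have \<theta>0: "\<theta> n \<tau> = 0 \<and> \<theta>' n \<tau> = 0" if "\<tau> \<notin> C" for n \<tau>
  proof (cases "\<tau> < s")
    case True
    have "real (Suc n) * (\<tau> - s) \<le> 0" "real (Suc n) * (\<tau> - t) \<le> 0"
      using True s by (intro mult_nonneg_nonpos; simp)+
    then show ?thesis by (simp add: \<theta>_def \<theta>'_def ramp_eq_0 tent_eq_0 del: of_nat_Suc)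
  next
    case False
    then have "\<tau> > t + 1" using that by (auto simp: C_def)
    then have "1 * 1 \<le> real (Suc n) * (\<tau> - s)" "1 * 1 \<le> real (Suc n) * (\<tau> - t)"
      using s by (intro mult_mono; simp)+
    then show ?thesis by (simp add: \<theta>_def \<theta>'_def ramp_eq_1 tent_eq_0 del: of_nat_Suc)
  qed
  have test: "test_function_on {0<..} (\<theta> n)" for n
  proof -
    have "{\<tau>. \<theta> n \<tau> \<noteq> 0} \<subseteq> C" using \<theta>0 by blast
    then have cl: "closure {\<tau>. \<theta> n \<tau> \<noteq> 0} \<subseteq> C"
      using C(1) by (simp add: closure_minimal compact_imp_closed)
    have "\<theta> n C1_differentiable_on UNIV"
      unfolding C1_differentiable_on_def
    proof (intro exI conjI ballI)
      show "(\<theta> n has_vector_derivative \<theta>' n \<tau>) (at \<tau>)" for \<tau>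
        using der by (simp add: has_real_derivative_iff_has_vector_derivative)
      show "continuous_on UNIV (\<theta>' n)" unfolding \<theta>'_def by (intro continuous_intros)
    qed
    then show ?thesis
      unfolding test_function_on_def using cl C compact_Int_closed[OF C(1), of "closure {\<tau>. \<theta> n \<tau> \<noteq> 0}"]
      by (auto simp: Int_absorb1)
  qed
  have deriv\<theta>: "deriv (\<theta> n) = \<theta>' n" for n
    using der by (auto intro!: DERIV_imp_deriv)
  have \<theta>f: "(\<lambda>\<tau>. \<theta>' n \<tau> *\<^sub>R f \<tau>) absolutely_integrable_on C" for n
    unfolding C_def \<theta>'_def
    by (intro absolutely_integrable_continuous_real continuous_intros contC[unfolded C_def])
  have \<theta>g: "(\<lambda>\<tau>. \<theta> n \<tau> *\<^sub>R g \<tau>) absolutely_integrable_on C" for n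
    using gC unfolding C_def \<theta>_def
    by (intro absolutely_integrable_continuous_bilinear[OF bilinear_scaleR] continuous_intros)
  have parts: "integral C (\<lambda>\<tau>. \<theta>' n \<tau> *\<^sub>R f \<tau>) = - integral C (\<lambda>\<tau>. \<theta> n \<tau> *\<^sub>R g \<tau>)" for n
  proof -
    have "(LINT \<tau>:{0<..}|lebesgue. \<theta>' n \<tau> *\<^sub>R f \<tau>) = - (LINT \<tau>:{0<..}|lebesgue. \<theta> n \<tau> *\<^sub>R g \<tau>)"
      using wd test[of n] unfolding weak_derivative_on_def deriv\<theta>[symmetric] by blast
    moreover have "(LINT \<tau>:{0<..}|lebesgue. \<theta>' n \<tau> *\<^sub>R f \<tau>) = integral C (\<lambda>\<tau>. \<theta>' n \<tau> *\<^sub>R f \<tau>)"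
      using \<theta>0 by (intro set_lebesgue_integral_eq_integral_support C \<theta>f) auto
    moreover have "(LINT \<tau>:{0<..}|lebesgue. \<theta> n \<tau> *\<^sub>R g \<tau>) = integral C (\<lambda>\<tau>. \<theta> n \<tau> *\<^sub>R g \<tau>)"
      using \<theta>0 by (intro set_lebesgue_integral_eq_integral_support C \<theta>g) auto
    ultimately show ?thesis by simp
  qed
  have "(\<lambda>n. integral C (\<lambda>\<tau>. \<theta>' n \<tau> *\<^sub>R f \<tau>)) \<longlonglongrightarrow> f s - f t"
  proof -
    have "integral C (\<lambda>\<tau>. \<theta>' n \<tau> *\<^sub>R f \<tau>) =
        integral C (\<lambda>\<tau>. (real (Suc n) * tent (real (Suc n) * (\<tau> - s))) *\<^sub>R f \<tau>)
      - integral C (\<lambda>\<tau>. (real (Suc n) * tent (real (Suc n) * (\<tau> - t))) *\<^sub>R f \<tau>)" for n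
      unfolding \<theta>'_def scaleR_diff_left C_def
      by (intro integral_diff integrable_continuous_real continuous_intros contC[unfolded C_def])
    moreover have "(\<lambda>n. integral C (\<lambda>\<tau>. (real (Suc n) * tent (real (Suc n) * (\<tau> - s))) *\<^sub>R f \<tau>)) \<longlonglongrightarrow> f s"
      using contC s unfolding C_def by (intro tent_average_tendsto) auto
    moreover have "(\<lambda>n. integral C (\<lambda>\<tau>. (real (Suc n) * tent (real (Suc n) * (\<tau> - t))) *\<^sub>R f \<tau>)) \<longlonglongrightarrow> f t"
      using contC s unfolding C_def by (intro tent_average_tendsto) auto
    ultimately show ?thesis by (simp add: tendsto_diff)
  qed
  then have lim1: "(\<lambda>n. integral C (\<lambda>\<tau>. \<theta> n \<tau> *\<^sub>R g \<tau>)) \<longlonglongrightarrow> f t - f s"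
    using tendsto_minus_cancel[of "\<lambda>n. integral C (\<lambda>\<tau>. \<theta> n \<tau> *\<^sub>R g \<tau>)" "f t - f s"] by (simp add: parts)
  let ?g = "\<lambda>\<tau>. if \<tau> \<in> {s<..t} then g \<tau> else 0"
  have dct: "?g integrable_on C" "(\<lambda>n. integral C (\<lambda>\<tau>. \<theta> n \<tau> *\<^sub>R g \<tau>)) \<longlonglongrightarrow> integral C ?g"
  proof (rule_tac [!] dominated_convergence[where h = "\<lambda>\<tau>. norm (g \<tau>)"])
    show "(\<lambda>\<tau>. \<theta> n \<tau> *\<^sub>R g \<tau>) integrable_on C" for n
      using \<theta>g set_lebesgue_integral_eq_integral(1) by blast
    then show "(\<lambda>\<tau>. \<theta> n \<tau> *\<^sub>R g \<tau>) integrable_on C" for n .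
    show "(\<lambda>\<tau>. norm (g \<tau>)) integrable_on C"
      using gC by (simp add: absolutely_integrable_on_def)
    then show "(\<lambda>\<tau>. norm (g \<tau>)) integrable_on C" .
    show "norm (\<theta> n \<tau> *\<^sub>R g \<tau>) \<le> norm (g \<tau>)" for n \<tau>
    proof -
      have "\<bar>\<theta> n \<tau>\<bar> \<le> 1"
        unfolding \<theta>_def using ramp_bounds[of "real (Suc n) * (\<tau> - s)"] ramp_bounds[of "real (Suc n) * (\<tau> - t)"]
        by linarith
      then show ?thesis by (simp add: mult_left_le_one_le)
    qed
    then show "norm (\<theta> n \<tau> *\<^sub>R g \<tau>) \<le> norm (g \<tau>)" for n \<tau> .
    show "(\<lambda>n. \<theta> n \<tau> *\<^sub>R g \<tau>) \<longlonglongrightarrow> ?g \<tau>" for \<tau>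
    proof -
      have step: "\<forall>\<^sub>F n in sequentially. ramp (real (Suc n) * (\<tau> - r)) = (if \<tau> > r then 1 else 0)" for r
      proof (cases "\<tau> > r")
        case True
        obtain n0 where n0: "inverse (real (Suc n0)) < \<tau> - r"
          using True reals_Archimedean[of "\<tau> - r"] by auto
        have "ramp (real (Suc n) * (\<tau> - r)) = 1" if "n \<ge> n0" for n
        proof (rule ramp_eq_1)
          have "1 = real (Suc n0) * inverse (real (Suc n0))" by simp
          also have "\<dots> \<le> real (Suc n) * (\<tau> - r)"
            using n0 that by (intro mult_mono) auto
          finally show "1 \<le> real (Suc n) * (\<tau> - r)" .
        qed
        then show ?thesis using True by (auto simp: eventually_sequentially)
      next
        case False
        then have "real (Suc n) * (\<tau> - r) \<le> 0" for n by (intro mult_nonneg_nonpos) auto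
        then show ?thesis using False by (simp only: ramp_eq_0) simp
      qed
      have "\<forall>\<^sub>F n in sequentially. \<theta> n \<tau> *\<^sub>R g \<tau> = ?g \<tau>"
        using step[of s] step[of t] by eventually_elim (use s in \<open>auto simp: \<theta>_def\<close>)
      then show ?thesis by (rule tendsto_eventually)
    qed
    then show "(\<lambda>n. \<theta> n \<tau> *\<^sub>R g \<tau>) \<longlonglongrightarrow> ?g \<tau>" for \<tau> .
  qed
  have "(?g has_integral (f t - f s)) C"
    using integrable_integral[OF dct(1)] LIMSEQ_unique[OF dct(2) lim1] by simp
  then have "(g has_integral (f t - f s)) {s<..t}"
    by (subst (asm) has_integral_restrict) (auto simp: C_def)
  then show ?thesis
    by (rule has_integral_spike_set_eq[THEN iffD1, rotated 2])
       (auto intro: negligible_subset[of "{s}"])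
qed

section \<open>The squared norm of an indefinite integral\<close>

text \<open>Summing the assumed estimate over a partition of \<open>[s, t]\<close> of mesh less than \<open>\<delta>\<close> gives
\<open>\<bar>F t - F s\<bar> \<le> e * (G t - G s)\<close>, where \<open>e\<close> is arbitrary.\<close>

lemma eq_of_dominated_increments:
  fixes F G :: "real \<Rightarrow> real"
  assumes st: "s \<le> t"
    and small: "\<And>e. e > 0 \<Longrightarrow> \<exists>\<delta>>0. \<forall>u v. s \<le> u \<longrightarrow> u \<le> v \<longrightarrow> v \<le> t \<longrightarrow> v - u < \<delta> \<longrightarrow>
                   \<bar>F v - F u\<bar> \<le> e * (G v - G u)"
  shows "F t = F s"
proof -
  have bound: "\<bar>F t - F s\<bar> \<le> e * (G t - G s)" if e: "e > 0" for e
  proof -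
    obtain \<delta> where \<delta>: "\<delta> > 0" "\<And>u v. s \<le> u \<Longrightarrow> u \<le> v \<Longrightarrow> v \<le> t \<Longrightarrow> v - u < \<delta> \<Longrightarrow>
        \<bar>F v - F u\<bar> \<le> e * (G v - G u)"
      using small[OF e] by blast
    obtain N :: nat where N: "N > 0" "(t - s) / real N < \<delta>"
    proof -
      obtain N :: nat where "(t - s) / \<delta> < real N" using reals_Archimedean2 by blast
      moreover from this have "N > 0" using st \<delta>(1)
        by (metis divide_nonneg_pos diff_ge_0_iff_ge gr0I not_le of_nat_0)
      ultimately show thesis using \<delta>(1) by (intro that[of N]) (auto simp: field_simps)
    qed
    define p where "p i = s + real i * ((t - s) / real N)" for i
    have step: "p (Suc i) - p i = (t - s) / real N" for i by (simp add: p_def add_divide_distrib distrib_right)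
    have step0: "(t - s) / real N \<ge> 0" using st by simp
    have pN: "p N = t" using N by (simp add: p_def)
    have p0: "p 0 = s" by (simp add: p_def)
    have ple: "p i \<le> p j" if "i \<le> j" for i j
      using that st by (auto simp: p_def intro!: mult_right_mono divide_right_mono)
    have "i \<le> N \<Longrightarrow> \<bar>F (p i) - F s\<bar> \<le> e * (G (p i) - G s)" for i
    proof (induction i)
      case 0
      then show ?case by (simp add: p0)
    next
      case (Suc i)
      have "\<bar>F (p (Suc i)) - F (p i)\<bar> \<le> e * (G (p (Suc i)) - G (p i))"
        using ple[of 0 i] ple[of i "Suc i"] ple[of "Suc i" N] Suc.prems step[of i] N(2)
        by (intro \<delta>(2)) (auto simp: p0 pN)
      then show ?case using Suc by (simp add: algebra_simps)
    qed
    then show ?thesis using pN by (metis order_refl)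
  qed
  show ?thesis
  proof (rule ccontr)
    assume "F t \<noteq> F s"
    then have pos: "\<bar>F t - F s\<bar> > 0" by simp
    define c where "c = \<bar>G t - G s\<bar> + 1"
    have c: "c > 0" "G t - G s < c" by (auto simp: c_def)
    have "\<bar>F t - F s\<bar> \<le> \<bar>F t - F s\<bar> / c * (G t - G s)"
      using pos c by (intro bound) simp
    also have "\<dots> < \<bar>F t - F s\<bar> / c * c"
      using pos c by (intro mult_strict_left_mono) auto
    finally show False using c by simp
  qed
qed

text \<open>The chain rule for \<open>\<parallel>f\<parallel>\<^sup>2\<close> when \<open>f\<close> is only an indefinite integral. On \<open>[u, v]\<close> the increment
\<open>\<parallel>f v\<parallel>\<^sup>2 - \<parallel>f u\<parallel>\<^sup>2 = (f v + f u) \<bullet> (f v - f u)\<close> is the integral of \<open>(f v + f u) \<bullet> g\<close>, and \<open>f v + f u\<close> differs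
little from \<open>2 f \<tau>\<close> by uniform continuity. Hence the difference of the two sides has increments
dominated by those of the indefinite integral of \<open>\<parallel>g\<parallel>\<close>.\<close>

lemma norm_square_has_integral:
  fixes f g :: "real \<Rightarrow> 'a::euclidean_space"
  assumes st: "s \<le> t" and cont: "continuous_on {s..t} f" and g: "g absolutely_integrable_on {s..t}"
    and ftc: "\<And>u v. s \<le> u \<Longrightarrow> u \<le> v \<Longrightarrow> v \<le> t \<Longrightarrow> (g has_integral (f v - f u)) {u..v}"
  shows "((\<lambda>\<tau>. 2 * (f \<tau> \<bullet> g \<tau>)) has_integral ((norm (f t))\<^sup>2 - (norm (f s))\<^sup>2)) {s..t}"
proof -
  have fg: "(\<lambda>\<tau>. 2 * (f \<tau> \<bullet> g \<tau>)) integrable_on {s..t}"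
    using absolutely_integrable_continuous_bilinear[OF bilinear_inner cont g]
    by (intro integrable_on_mult_right) (auto dest: set_lebesgue_integral_eq_integral(1))
  have ng: "(\<lambda>\<tau>. norm (g \<tau>)) integrable_on {s..t}"
    using g by (simp add: absolutely_integrable_on_def)
  define F where "F = (\<lambda>v. (norm (f v))\<^sup>2 - integral {s..v} (\<lambda>\<tau>. 2 * (f \<tau> \<bullet> g \<tau>)))"
  define G where "G = (\<lambda>v. integral {s..v} (\<lambda>\<tau>. norm (g \<tau>)))"
  have "F t = F s"
  proof (rule eq_of_dominated_increments[OF st, where G = G])
    fix e :: real assume "e > 0"
    have "uniformly_continuous_on {s..t} f"
      using cont by (simp add: compact_uniformly_continuous)
    then obtain \<delta> where \<delta>: "\<delta> > 0"
      "\<And>u v. u \<in> {s..t} \<Longrightarrow> v \<in> {s..t} \<Longrightarrow> dist v u < \<delta> \<Longrightarrow> dist (f v) (f u) < e / 2"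
      using \<open>e > 0\<close> unfolding uniformly_continuous_on_def by (metis half_gt_zero)
    show "\<exists>\<delta>>0. \<forall>u v. s \<le> u \<longrightarrow> u \<le> v \<longrightarrow> v \<le> t \<longrightarrow> v - u < \<delta> \<longrightarrow> \<bar>F v - F u\<bar> \<le> e * (G v - G u)"
    proof (intro exI[of _ \<delta>] conjI allI impI \<delta>(1))
      fix u v assume uv: "s \<le> u" "u \<le> v" "v \<le> t" "v - u < \<delta>"
      have sub: "{u..v} \<subseteq> {s..t}" "{s..v} \<subseteq> {s..t}" using uv by auto
      have fg': "(\<lambda>\<tau>. 2 * (f \<tau> \<bullet> g \<tau>)) integrable_on {u..v}"
        using integrable_on_subinterval[OF fg sub(1)] .
      have ng': "(\<lambda>\<tau>. norm (g \<tau>)) integrable_on {u..v}"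
        using integrable_on_subinterval[OF ng sub(1)] .
      have 1: "integral {s..v} (\<lambda>\<tau>. 2 * (f \<tau> \<bullet> g \<tau>)) - integral {s..u} (\<lambda>\<tau>. 2 * (f \<tau> \<bullet> g \<tau>))
          = integral {u..v} (\<lambda>\<tau>. 2 * (f \<tau> \<bullet> g \<tau>))"
        using Henstock_Kurzweil_Integration.integral_combine[OF uv(1,2) integrable_on_subinterval[OF fg sub(2)]] by simp
      have 2: "G v - G u = integral {u..v} (\<lambda>\<tau>. norm (g \<tau>))"
        using Henstock_Kurzweil_Integration.integral_combine[OF uv(1,2) integrable_on_subinterval[OF ng sub(2)]] by (simp add: G_def)
      have 3: "((\<lambda>\<tau>. (f v + f u) \<bullet> g \<tau>) has_integral (f v + f u) \<bullet> (f v - f u)) {u..v}"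
        using has_integral_linear[OF ftc[OF uv(1-3)] bounded_linear_inner_right, of "f v + f u"]
        by (simp add: o_def)
      have "F v - F u = (f v + f u) \<bullet> (f v - f u) - integral {u..v} (\<lambda>\<tau>. 2 * (f \<tau> \<bullet> g \<tau>))"
      proof -
        have "(f v + f u) \<bullet> (f v - f u) = (norm (f v))\<^sup>2 - (norm (f u))\<^sup>2"
          by (simp add: power2_norm_eq_inner inner_add_left inner_diff_right inner_commute[of "f u" "f v"])
        then show ?thesis using 1 unfolding F_def by linarith
      qed
      also have "\<dots> = integral {u..v} (\<lambda>\<tau>. (f v + f u) \<bullet> g \<tau> - 2 * (f \<tau> \<bullet> g \<tau>))"
        using 3 fg' by (subst integral_diff) (auto simp: integral_unique)
      finally have "\<bar>F v - F u\<bar> = norm (integral {u..v} (\<lambda>\<tau>. (f v + f u) \<bullet> g \<tau> - 2 * (f \<tau> \<bullet> g \<tau>)))"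
        by simp
      also have "\<dots> \<le> integral {u..v} (\<lambda>\<tau>. e * norm (g \<tau>))"
      proof (rule integral_norm_bound_integral)
        show "(\<lambda>\<tau>. (f v + f u) \<bullet> g \<tau> - 2 * (f \<tau> \<bullet> g \<tau>)) integrable_on {u..v}"
          using 3 fg' by (intro integrable_diff) auto
        show "(\<lambda>\<tau>. e * norm (g \<tau>)) integrable_on {u..v}"
          using ng' by (rule integrable_on_mult_right)
        fix \<tau> assume \<tau>: "\<tau> \<in> {u..v}"
        have "dist (f v) (f \<tau>) < e / 2" "dist (f u) (f \<tau>) < e / 2"
          by (rule \<delta>(2); use \<tau> uv in \<open>auto simp: dist_real_def\<close>)+
        then have "norm ((f v - f \<tau>) + (f u - f \<tau>)) \<le> e"
          using norm_triangle_ineq[of "f v - f \<tau>" "f u - f \<tau>"] by (simp add: dist_norm)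
        moreover have "(f v + f u) \<bullet> g \<tau> - 2 * (f \<tau> \<bullet> g \<tau>) = ((f v - f \<tau>) + (f u - f \<tau>)) \<bullet> g \<tau>"
          by (simp add: inner_add_left inner_diff_left)
        ultimately show "norm ((f v + f u) \<bullet> g \<tau> - 2 * (f \<tau> \<bullet> g \<tau>)) \<le> e * norm (g \<tau>)"
          using Cauchy_Schwarz_ineq2[of "(f v - f \<tau>) + (f u - f \<tau>)" "g \<tau>"]
          by (metis mult_right_mono norm_ge_zero order_trans real_norm_def)
      qed
      also have "\<dots> = e * (G v - G u)" by (simp add: 2)
      finally show "\<bar>F v - F u\<bar> \<le> e * (G v - G u)" .
    qed
  qed
  then have "integral {s..t} (\<lambda>\<tau>. 2 * (f \<tau> \<bullet> g \<tau>)) = (norm (f t))\<^sup>2 - (norm (f s))\<^sup>2"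
    by (simp add: F_def)
  with fg show ?thesis by (metis integrable_integral)
qed

section \<open>Integrably perturbed dissipation\<close>

lemma has_integral_le_negligible:
  fixes f g :: "'a::euclidean_space \<Rightarrow> real"
  assumes "(f has_integral i) S" "(g has_integral j) S" "negligible N"
    and "\<And>x. x \<in> S - N \<Longrightarrow> f x \<le> g x"
  shows "i \<le> j"
proof (rule has_integral_le)
  show "((\<lambda>x. if x \<in> N then g x else f x) has_integral i) S"
    using assms(3) _ assms(1) by (rule has_integral_spike) auto
qed (use assms in auto)

lemma convergent_at_top_of_integrable_derivative:
  fixes f g :: "real \<Rightarrow> 'a::euclidean_space"
  assumes g: "g absolutely_integrable_on {c..}"
    and ftc: "\<And>t. c \<le> t \<Longrightarrow> (g has_integral (f t - f c)) {c..t}"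
  shows "\<exists>l. (f \<longlongrightarrow> l) at_top"
proof -
  have "((\<lambda>t. LINT \<tau>:{c..t}|lebesgue. g \<tau>) \<longlongrightarrow> (LINT \<tau>:{c..}|lebesgue. g \<tau>)) at_top"
    by (rule tendsto_set_lebesgue_integral_at_top) (use g in auto)
  moreover have "\<forall>\<^sub>F t in at_top. (LINT \<tau>:{c..t}|lebesgue. g \<tau>) = f t - f c"
    using eventually_ge_at_top[of c]
  proof eventually_elim
    case (elim t)
    have "g absolutely_integrable_on {c..t}"
      using g by (rule set_integrable_subset) auto
    then show ?case using ftc[OF elim] set_lebesgue_integral_eq_integral(2) integral_unique by metis
  qed
  ultimately have "((\<lambda>t. f t - f c) \<longlongrightarrow> (LINT \<tau>:{c..}|lebesgue. g \<tau>)) at_top"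
    by (rule Lim_transform_eventually)
  then have "((\<lambda>t. f t - f c + f c) \<longlongrightarrow> (LINT \<tau>:{c..}|lebesgue. g \<tau>) + f c) at_top"
    by (intro tendsto_intros)
  then show ?thesis by auto
qed

lemma bounded_on_half_line:
  fixes d :: "real \<Rightarrow> 'a::real_normed_vector"
  assumes cont: "continuous_on {c..} d" and lim: "(d \<longlongrightarrow> l) at_top"
  obtains B where "B \<ge> 0" "\<And>t. c \<le> t \<Longrightarrow> norm (d t) \<le> B"
proof -
  have "\<forall>\<^sub>F t in at_top. dist (d t) l < 1" using lim by (rule tendstoD) simp
  then obtain T where T: "\<And>t. t \<ge> T \<Longrightarrow> dist (d t) l < 1"
    unfolding eventually_at_top_linorder by blast
  have "compact (d ` {c..T})"
    by (intro compact_continuous_image compact_Icc continuous_on_subset[OF cont]) auto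
  then obtain M where M: "\<And>t. t \<in> {c..T} \<Longrightarrow> norm (d t) \<le> M"
    by (fastforce dest!: compact_imp_bounded simp: bounded_iff)
  show ?thesis
  proof
    show "max M (norm l + 1) \<ge> 0" by (simp add: max.coboundedI2)
    fix t assume "c \<le> t"
    show "norm (d t) \<le> max M (norm l + 1)"
    proof (cases "t \<le> T")
      case True
      then show ?thesis using M[of t] \<open>c \<le> t\<close> by simp
    next
      case False
      then show ?thesis
        using T[of t] norm_triangle_ineq2[of "d t" l] by (simp add: dist_norm)
    qed
  qed
qed

text \<open>A differential inequality \<open>u' + g \<le> k (1 + u)\<close> in integrated form, with \<open>g \<ge> 0\<close> and \<open>k\<close> integrable up to
infinity: \<open>u\<close> is bounded and convergent, and \<open>g\<close> cannot stay away from \<open>0\<close> since its integral is finite.\<close>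

lemma perturbed_dissipation:
  fixes u g k :: "real \<Rightarrow> real"
  assumes u: "continuous_on {c..} u" "\<And>t. c \<le> t \<Longrightarrow> 0 \<le> u t"
    and g: "continuous_on {c..} g" "\<And>t. c \<le> t \<Longrightarrow> 0 \<le> g t"
    and k: "continuous_on {c..} k" "\<And>t. c \<le> t \<Longrightarrow> 0 \<le> k t" "k absolutely_integrable_on {c..}"
    and ineq: "\<And>s t. c \<le> s \<Longrightarrow> s \<le> t \<Longrightarrow>
       u t - u s + integral {s..t} g \<le> integral {s..t} (\<lambda>\<tau>. k \<tau> * (1 + u \<tau>))"
  shows "\<exists>l. (u \<longlongrightarrow> l) at_top" and "\<exists>B. \<forall>t\<ge>c. u t \<le> B"
    and "e > 0 \<Longrightarrow> \<exists>t\<ge>T. g t < e"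
proof -
  have contI: "continuous_on {s..t} u" "continuous_on {s..t} g" "continuous_on {s..t} k" if "c \<le> s" for s t
    using that u(1) g(1) k(1) by (auto intro: continuous_on_subset)
  have intk: "k integrable_on {s..t}" if "c \<le> s" for s t
    using contI(3)[OF that] by (rule integrable_continuous_real)
  have intku: "(\<lambda>\<tau>. k \<tau> * (1 + u \<tau>)) integrable_on {s..t}" if "c \<le> s" for s t
    by (intro integrable_continuous_real continuous_intros contI[OF that])
  have intg0: "0 \<le> integral {s..t} g" if "c \<le> s" for s t
    using that g(2) by (intro integral_nonneg integrable_continuous_real contI) auto
  define I where "I t = integral {c..t} k" for t
  have comb: "I t - I s = integral {s..t} k" if "c \<le> s" "s \<le> t" for s t
    using Henstock_Kurzweil_Integration.integral_combine[OF that intk[OF order_refl, of t]] by (simp add: I_def)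
  have Imono: "I s \<le> I t" if "c \<le> s" "s \<le> t" for s t
    using comb[OF that] that k(2) intk by (smt (verit) Henstock_Kurzweil_Integration.integral_nonneg atLeastAtMost_iff)
  have "\<exists>l. (I \<longlongrightarrow> l) at_top"
    by (rule convergent_at_top_of_integrable_derivative[OF k(3)])
       (use intk in \<open>auto simp: I_def intro!: integrable_integral\<close>)
  then obtain L where L: "(I \<longlongrightarrow> L) at_top" by blast
  have IL: "I t \<le> L" if "c \<le> t" for t
    by (rule tendsto_lowerbound[OF L])
       (use that in \<open>auto intro!: eventually_mono[OF eventually_ge_at_top[of t]] Imono\<close>)
  have bdd: "\<exists>B. \<forall>t\<ge>c. u t \<le> B"
  proof -
    have "\<forall>\<^sub>F t in at_top. I t > L - 1 / 2" using L by (rule order_tendstoD) simp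
    then obtain s where s: "s \<ge> c" "I s > L - 1 / 2"
      using eventually_happens[OF eventually_conj[OF eventually_ge_at_top[of c]]] by force
    \<comment> \<open>past \<open>s\<close> the mass of \<open>k\<close> is at most one half, so that the right-hand side at a maximum point of \<open>u\<close>
        can be absorbed on the left\<close>
    have late: "u t \<le> 2 * u s + 1" if "t \<ge> s" for t
    proof -
      have "{s..t} \<noteq> {}" using that by simp
      from continuous_attains_sup[OF compact_Icc this contI(1)[OF s(1)]]
      obtain m where m: "m \<in> {s..t}" "\<And>\<tau>. \<tau> \<in> {s..t} \<Longrightarrow> u \<tau> \<le> u m" by blast
      have "u m - u s \<le> u m - u s + integral {s..m} g" using intg0[OF s(1)] by simp
      also have "\<dots> \<le> integral {s..m} (\<lambda>\<tau>. k \<tau> * (1 + u \<tau>))"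
        using m s by (intro ineq) auto
      also have "\<dots> \<le> integral {s..m} (\<lambda>\<tau>. k \<tau> * (1 + u m))"
        using m s k(2) by (intro integral_le intku integrable_on_mult_left intk mult_left_mono) auto
      also have "\<dots> = (I m - I s) * (1 + u m)"
        using comb[of s m] s m by simp
      also have "\<dots> \<le> 1 / 2 * (1 + u m)"
        using IL[of m] s m u(2)[of m] by (intro mult_right_mono) auto
      finally have "u m \<le> 2 * u s + 1" by simp
      then show ?thesis using m(2)[of t] that by simp
    qed
    have "{c..s} \<noteq> {}" using s(1) by simp
    from continuous_attains_sup[OF compact_Icc this contI(1)[OF order_refl]]
    obtain B where B: "\<And>t. t \<in> {c..s} \<Longrightarrow> u t \<le> B" by blast
    have "u t \<le> max B (2 * u s + 1)" if "t \<ge> c" for t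
      using late[of t] B[of t] that by (cases "t \<ge> s") auto
    then show ?thesis by blast
  qed
  then show "\<exists>B. \<forall>t\<ge>c. u t \<le> B" .
  then obtain B where B: "\<And>t. t \<ge> c \<Longrightarrow> u t \<le> B" by blast
  have ineqB: "u t - u s + integral {s..t} g \<le> (1 + B) * (I t - I s)" if st: "c \<le> s" "s \<le> t" for s t
  proof -
    have "integral {s..t} (\<lambda>\<tau>. k \<tau> * (1 + u \<tau>)) \<le> integral {s..t} (\<lambda>\<tau>. k \<tau> * (1 + B))"
      using st k(2) B by (intro integral_le intku integrable_on_mult_left intk mult_left_mono) auto
    also have "\<dots> = (1 + B) * (I t - I s)" using comb[OF st] by simp
    finally show ?thesis using ineq[OF st] by linarith
  qed
  show "\<exists>l. (u \<longlongrightarrow> l) at_top"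
  proof -
    have B0: "B \<ge> 0" using B[of c] u(2)[of c] by simp
    \<comment> \<open>cut off at \<open>c\<close> to be monotone on the whole line\<close>
    define v where "v t = (1 + B) * I (max c t) - u (max c t)" for t
    have mono: "mono v"
    proof (rule monoI)
      fix s t :: real assume "s \<le> t"
      then have "max c s \<le> max c t" by simp
      then show "v s \<le> v t"
        using ineqB[of "max c s" "max c t"] intg0[of "max c s" "max c t"]
        by (simp add: v_def right_diff_distrib)
    qed
    have upper: "v t \<le> (1 + B) * L" for t
    proof -
      have "(1 + B) * I (max c t) \<le> (1 + B) * L" using IL B0 by (intro mult_left_mono) auto
      then show ?thesis using u(2)[of "max c t"] by (simp add: v_def)
    qed
    have "incseq (\<lambda>n. v (real n))" using mono by (auto simp: incseq_def mono_def)
    then obtain l where "(\<lambda>n. v (real n)) \<longlonglongrightarrow> l"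
      by (rule incseq_convergent[of _ "(1 + B) * L"]) (use upper in auto)
    then have l: "(v \<longlongrightarrow> l) at_top" by (rule tendsto_at_topI_sequentially_real[OF mono])
    have "((\<lambda>t. (1 + B) * I t - v t) \<longlongrightarrow> (1 + B) * L - l) at_top"
      by (intro tendsto_intros L l)
    moreover have "\<forall>\<^sub>F t in at_top. (1 + B) * I t - v t = u t"
      using eventually_ge_at_top[of c] by eventually_elim (simp add: v_def)
    ultimately show ?thesis using Lim_transform_eventually by blast
  qed
  assume e: "e > 0"
  show "\<exists>t\<ge>T. g t < e"
  proof (rule ccontr)
    assume "\<not> (\<exists>t\<ge>T. g t < e)"
    then have ge: "\<And>t. t \<ge> T \<Longrightarrow> e \<le> g t" by force
    define s where "s = max c T"
    define M where "M = (1 + B) * (L - I s) + u s"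
    define t where "t = s + (\<bar>M\<bar> + 1) / e"
    have st: "c \<le> s" "T \<le> s" "s \<le> t" using e by (auto simp: s_def t_def)
    have B0: "B \<ge> 0" using B[of c] u(2)[of c] by simp
    have "integral {s..t} (\<lambda>_. e) \<le> integral {s..t} g"
      using st ge by (intro integral_le integrable_continuous_real contI continuous_intros) auto
    then have "\<bar>M\<bar> + 1 \<le> integral {s..t} g"
      using st e by (simp add: t_def content_real)
    moreover have "integral {s..t} g \<le> M"
    proof -
      have "(1 + B) * (I t - I s) \<le> (1 + B) * (L - I s)"
        using IL[of t] st B0 by (intro mult_left_mono) auto
      then show ?thesis using ineqB[OF st(1,3)] u(2)[of t] st by (simp add: M_def)
    qed
    ultimately show False by linarith
  qed
qed

section \<open>The energy and its subgradients\<close>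

lemma finite_edge_differences: "finite {x $ u - x $ v | u v. u \<in> e \<and> v \<in> (e :: 'v::finite set)}"
  by (rule finite_subset[OF _ finite_imageI[OF finite_class.finite_UNIV, of "\<lambda>(u, v). x $ u - x $ v"]]) auto

lemma edge_diff_ge: "u \<in> e \<Longrightarrow> v \<in> e \<Longrightarrow> x $ u - x $ v \<le> edge_diff e x"
  unfolding edge_diff_def by (rule Max_ge[OF finite_edge_differences]) blast

lemma edge_diff_attained:
  assumes "e \<noteq> {}" obtains u v where "u \<in> e" "v \<in> e" "edge_diff e x = x $ u - x $ v"
proof -
  have "edge_diff e x \<in> {x $ u - x $ v | u v. u \<in> e \<and> v \<in> e}"
    unfolding edge_diff_def using assms by (intro Max_in finite_edge_differences) auto
  then show ?thesis using that by blast
qed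

lemma edge_diff_nonneg: "e \<noteq> {} \<Longrightarrow> 0 \<le> edge_diff e x"
  using edge_diff_ge[of _ e _ x] by fastforce

lemma edge_diff_le_add:
  assumes "e \<noteq> {}" shows "edge_diff e y \<le> edge_diff e x + 2 * norm (y - x)"
proof -
  obtain u v where uv: "u \<in> e" "v \<in> e" "edge_diff e y = y $ u - y $ v"
    by (rule edge_diff_attained[OF assms])
  have "edge_diff e y = (x $ u - x $ v) + ((y - x) $ u - (y - x) $ v)" by (simp add: uv)
  also have "\<dots> \<le> edge_diff e x + 2 * norm (y - x)"
    using edge_diff_ge[OF uv(1,2), of x] component_le_norm_cart[of "y - x" u]
      component_le_norm_cart[of "y - x" v] by linarith
  finally show ?thesis .
qed

lemma edge_diff_le:
  assumes "e \<noteq> {}" shows "edge_diff e x \<le> 2 * norm x"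
proof -
  have "edge_diff e 0 = 0" by (rule edge_diff_attained[OF assms, of 0]) simp
  then show ?thesis using edge_diff_le_add[OF assms, of x 0] by simp
qed

lemma continuous_on_edge_diff:
  fixes e :: "'v::finite set"
  assumes "e \<noteq> {}" shows "continuous_on UNIV (edge_diff e)"
proof (rule continuous_onI)
  fix x :: "real ^ 'v" and r :: real assume "r > 0"
  show "\<exists>d>0. \<forall>y\<in>UNIV. dist y x < d \<longrightarrow> dist (edge_diff e y) (edge_diff e x) \<le> r"
  proof (intro exI[of _ "r / 2"] conjI ballI impI)
    fix y assume "dist y x < r / 2"
    then show "dist (edge_diff e y) (edge_diff e x) \<le> r"
      using edge_diff_le_add[OF assms, of y x] edge_diff_le_add[OF assms, of x y]
      by (simp add: dist_norm norm_minus_commute[of x y] abs_le_iff)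
  qed (use \<open>r > 0\<close> in simp)
qed

lemma hypergraph_edge_nonempty: "hypergraph E w \<Longrightarrow> e \<in> E \<Longrightarrow> e \<noteq> {}"
  unfolding hypergraph_def by fastforce

lemma continuous_on_energy:
  assumes G: "hypergraph E w" and p: "1 \<le> p" shows "continuous_on UNIV (energy p E w)"
  unfolding energy_def
proof (intro continuous_on_mult_left continuous_on_sum)
  fix e assume "e \<in> E"
  then have ne: "e \<noteq> {}" using G hypergraph_edge_nonempty by blast
  show "continuous_on UNIV (\<lambda>x. edge_diff e x powr p)"
    by (rule continuous_on_powr'[OF continuous_on_edge_diff[OF ne] continuous_on_const])
       (use edge_diff_nonneg[OF ne] p in auto)
qed

lemma mem_dphi_iff:
  "\<eta> \<in> dphi p E w x \<longleftrightarrow> (\<forall>z. \<eta> \<bullet> (z - x) \<le> energy p E w z - energy p E w x)"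
  unfolding dphi_def subdifferential_def by simp

lemma powr_increment_le:
  fixes p r :: real
  assumes p: "1 \<le> p" "p \<le> 3" and r: "0 \<le> r"
  shows "(r + 2) powr p - r powr p \<le> 2 * p * (r + 2)\<^sup>2"
proof -
  have cont: "continuous_on {r..r + 2} (\<lambda>s. s powr p)"
    by (rule continuous_on_powr') (use p r in \<open>auto intro: continuous_intros\<close>)
  have der: "((\<lambda>s. s powr p) has_real_derivative p * s powr (p - 1)) (at s)" if "r < s" for s
    by (rule has_real_derivative_powr) (use that r in simp)
  have "\<exists>l z. r < z \<and> z < r + 2 \<and> ((\<lambda>s. s powr p) has_real_derivative l) (at z) \<and>
      (r + 2) powr p - r powr p = (r + 2 - r) * l"
    by (rule MVT[OF _ cont]) (use der in \<open>auto simp: real_differentiable_def\<close>)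
  then obtain l z where z: "r < z" "z < r + 2" "((\<lambda>s. s powr p) has_real_derivative l) (at z)"
    "(r + 2) powr p - r powr p = 2 * l" by auto
  have "l = p * z powr (p - 1)" using DERIV_unique[OF z(3) der[OF z(1)]] .
  moreover have "z powr (p - 1) \<le> (r + 2) powr (p - 1)"
    using z r p by (intro powr_mono2) auto
  moreover have "(r + 2) powr (p - 1) \<le> (r + 2) powr 2"
    using r p by (intro powr_mono) auto
  moreover have "(r + 2) powr 2 = (r + 2)\<^sup>2" using r by simp
  ultimately have "l \<le> p * (r + 2)\<^sup>2" using p by simp
  then show ?thesis using z(4) by simp
qed

text \<open>Testing a subgradient \<open>\<eta>\<close> with its own direction bounds \<open>\<parallel>\<eta>\<parallel>\<close> by an increment of the energy over a step
of length one, which by the mean value theorem grows like the power \<open>p - 1 \<le> 2\<close> of \<open>\<parallel>x\<parallel>\<close>.\<close>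

lemma dphi_quadratic_growth:
  assumes G: "hypergraph E w" and p: "1 \<le> p" "p \<le> 3"
  obtains C where "C \<ge> 0" "\<And>x \<eta>. \<eta> \<in> dphi p E w x \<Longrightarrow> norm \<eta> \<le> C * (1 + (norm x)\<^sup>2)"
proof
  define W where "W = (\<Sum>e\<in>E. w e)"
  have w: "w e \<ge> 0" if "e \<in> E" for e using G that by (fastforce simp: hypergraph_def)
  show "16 * W \<ge> 0" using w by (auto simp: W_def intro!: sum_nonneg)
  fix x \<eta> assume \<eta>: "\<eta> \<in> dphi p E w x"
  show "norm \<eta> \<le> 16 * W * (1 + (norm x)\<^sup>2)"
  proof (cases "\<eta> = 0")
    case True
    then show ?thesis using \<open>16 * W \<ge> 0\<close> by simp
  next
    case False
    define v where "v = \<eta> /\<^sub>R norm \<eta>"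
    have nv: "norm v = 1" using False by (simp add: v_def)
    have "norm \<eta> = \<eta> \<bullet> v"
      using False by (simp add: v_def power2_norm_eq_inner[symmetric] power2_eq_square)
    also have "\<dots> \<le> energy p E w (x + v) - energy p E w x"
      using \<eta> unfolding mem_dphi_iff by (metis add_diff_cancel_left')
    also have "\<dots> = (1 / p) * (\<Sum>e\<in>E. w e * (edge_diff e (x + v) powr p - edge_diff e x powr p))"
      by (simp add: energy_def sum_subtractf right_diff_distrib diff_divide_distrib)
    also have "\<dots> \<le> (1 / p) * (\<Sum>e\<in>E. w e * (2 * p * (8 * (1 + (norm x)\<^sup>2))))"
    proof (intro mult_left_mono sum_mono w)
      fix e assume e: "e \<in> E"
      then have ne: "e \<noteq> {}" using G hypergraph_edge_nonempty by blast
      let ?f = "edge_diff e x"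
      have f: "0 \<le> ?f" "?f \<le> 2 * norm x" using edge_diff_nonneg[OF ne] edge_diff_le[OF ne] by auto
      have "edge_diff e (x + v) \<le> ?f + 2" using edge_diff_le_add[OF ne, of "x + v" x] nv by simp
      then have "edge_diff e (x + v) powr p - ?f powr p \<le> (?f + 2) powr p - ?f powr p"
        using edge_diff_nonneg[OF ne] p by (simp add: powr_mono2)
      also have "\<dots> \<le> 2 * p * (?f + 2)\<^sup>2" using powr_increment_le p f by simp
      also have "\<dots> \<le> 2 * p * (8 * (1 + (norm x)\<^sup>2))"
      proof (intro mult_left_mono)
        have "(?f + 2)\<^sup>2 \<le> (2 * norm x + 2)\<^sup>2" using f by (intro power_mono) auto
        also have "\<dots> \<le> 8 * (1 + (norm x)\<^sup>2)"
          using zero_le_power2[of "norm x - 1"] by (simp add: power2_eq_square algebra_simps)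
        finally show "(?f + 2)\<^sup>2 \<le> 8 * (1 + (norm x)\<^sup>2)" .
      qed (use p in simp)
      finally show "edge_diff e (x + v) powr p - ?f powr p \<le> 2 * p * (8 * (1 + (norm x)\<^sup>2))" .
    qed (use p in auto)
    also have "\<dots> = 16 * W * (1 + (norm x)\<^sup>2)"
      using p by (simp add: W_def sum_distrib_right[symmetric])
    finally show ?thesis .
  qed
qed

section \<open>The constraint and its normal cone\<close>

text \<open>The orthogonal projection onto the vectors that vanish at the vertices with prescribed values. It
describes both the constraint and its normal cone: \<open>x\<close> is admissible for \<open>c\<close> when \<open>x - c\<close> is fixed
by the projection (if \<open>free_part c = 0\<close>), and the normals are the vectors it annihilates.\<close>

definition free_part :: "real ^ ('n::finite + 'm::finite) \<Rightarrow> real ^ ('n + 'm)" where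
  "free_part x = (\<chi> i. case i of Inl k \<Rightarrow> x $ i | Inr k \<Rightarrow> 0)"

lemma free_part_nth [simp]:
  "free_part x $ Inl k = x $ Inl k" "free_part x $ Inr j = 0"
  by (simp_all add: free_part_def)

lemma vec_eq_sum_iff:
  "(x :: 'a ^ ('n::finite + 'm::finite)) = y \<longleftrightarrow> (\<forall>k. x $ Inl k = y $ Inl k) \<and> (\<forall>j. x $ Inr j = y $ Inr j)"
  by (metis vec_eq_iff sum.exhaust)

lemma inner_free_part: "x \<bullet> free_part y = free_part x \<bullet> free_part y"
  "free_part x \<bullet> y = free_part x \<bullet> free_part y"
  unfolding inner_vec_def by (auto intro!: sum.cong simp: free_part_def split: sum.splits)

lemma bounded_linear_free_part: "bounded_linear free_part"
  by (rule linear_conv_bounded_linear[THEN iffD1])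
     (auto intro!: linearI simp: vec_eq_sum_iff)

lemma free_part_eq_self_iff: "free_part x = x \<longleftrightarrow> (\<forall>j. x $ Inr j = 0)"
  by (auto simp: vec_eq_sum_iff)

lemma mem_dI_iff_variational:
  "\<xi> \<in> dI c x \<longleftrightarrow> x \<in> constraint_set c \<and> (\<forall>z\<in>constraint_set c. \<xi> \<bullet> (z - x) \<le> 0)"
proof (cases "x \<in> constraint_set c")
  case True
  have "ereal r \<le> indicator_fun (constraint_set c) z - 0 \<longleftrightarrow> (z \<in> constraint_set c \<longrightarrow> r \<le> 0)" for r z
    by (simp add: indicator_fun_def zero_ereal_def)
  with True show ?thesis by (auto simp: dI_def subdifferential_def indicator_fun_def)
next
  case False
  then show ?thesis by (simp add: dI_def subdifferential_def indicator_fun_def)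
qed

text \<open>At an admissible point the normal cone to the constraint set is the orthogonal complement of its
direction space.\<close>

lemma mem_dI_iff: "\<xi> \<in> dI c x \<longleftrightarrow> x \<in> constraint_set c \<and> free_part \<xi> = 0"
proof
  assume \<xi>: "\<xi> \<in> dI c x"
  then have x: "x \<in> constraint_set c" by (simp add: mem_dI_iff_variational)
  then have "x + free_part \<xi> \<in> constraint_set c" by (auto simp: constraint_set_def)
  then have "\<xi> \<bullet> free_part \<xi> \<le> 0"
    using \<xi> unfolding mem_dI_iff_variational by (metis add_diff_cancel_left')
  then have "free_part \<xi> \<bullet> free_part \<xi> \<le> 0" by (subst inner_free_part(1)[symmetric])
  then have "free_part \<xi> \<bullet> free_part \<xi> = 0" using inner_ge_zero[of "free_part \<xi>"] by linarith
  then show "x \<in> constraint_set c \<and> free_part \<xi> = 0" using x by simp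
next
  assume A: "x \<in> constraint_set c \<and> free_part \<xi> = 0"
  have "\<xi> \<bullet> (z - x) = 0" if "z \<in> constraint_set c" for z
  proof -
    have "free_part (z - x) = z - x"
      using A that by (auto simp: free_part_eq_self_iff constraint_set_def)
    then have "\<xi> \<bullet> (z - x) = free_part \<xi> \<bullet> free_part (z - x)"
      by (metis inner_free_part(1))
    then show ?thesis using A by simp
  qed
  then show "\<xi> \<in> dI c x"
    using A by (simp add: mem_dI_iff_variational)
qed

lemma constraint_set_iff:
  "free_part c = 0 \<Longrightarrow> v \<in> constraint_set c \<longleftrightarrow> v = free_part v + c"
  by (auto simp: vec_eq_sum_iff constraint_set_def)

section \<open>Convergence of the constrained flow\<close>

text \<open>The flow on a half-line, reduced to what the convergence proof uses: the curve \<open>x\<close> is an indefinite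
integral of \<open>x'\<close>, the inclusion holds on free components outside a null set, and \<open>x\<close> carries the
prescribed values \<open>a\<close>, where \<open>a\<close> vanishes on the free components; the latter two are both expressed by
\<open>constr\<close>. An equilibrium is likewise given by a point \<open>y = free_part y + a_inf\<close> together with a
subgradient \<open>\<zeta>\<close> of the energy at \<open>y\<close> whose free components are those of \<open>h_inf\<close>.\<close>

locale constrained_flow =
  fixes p :: real and E :: "('n::finite + 'm::finite) set set" and w :: "('n + 'm) set \<Rightarrow> real"
    and a h x x' :: "real \<Rightarrow> real ^ ('n + 'm)" and a_inf h_inf :: "real ^ ('n + 'm)"
    and N :: "real set" and c :: real
  assumes G: "hypergraph E w" and p: "1 \<le> p" "p \<le> 3"
    and cont: "continuous_on {c..} x" "continuous_on {c..} a" "continuous_on {c..} h"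
    and x'_int: "\<And>s t. c \<le> s \<Longrightarrow> s \<le> t \<Longrightarrow> x' absolutely_integrable_on {s..t}"
    and ftc: "\<And>s t. c \<le> s \<Longrightarrow> s \<le> t \<Longrightarrow> (x' has_integral (x t - x s)) {s..t}"
    and N: "negligible N"
    and flow: "\<And>t. c \<le> t \<Longrightarrow> t \<notin> N \<Longrightarrow>
                 \<exists>\<eta>\<in>dphi p E w (x t). free_part (x' t) = free_part (h t - \<eta>)"
    and constr: "\<And>t. c \<le> t \<Longrightarrow> x t = free_part (x t) + a t"
    and a_lim: "(a \<longlongrightarrow> a_inf) at_top"
    and a_int: "(\<lambda>t. a t - a_inf) absolutely_integrable_on {c..}"
    and h_int: "(\<lambda>t. h t - h_inf) absolutely_integrable_on {c..}"
begin

interpretation free: bounded_linear free_part by (rule bounded_linear_free_part)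

text \<open>The excess over the equilibrium \<open>y\<close> of the energy tilted by \<open>h_inf\<close>. Since \<open>x t\<close> is admissible for \<open>a t\<close>
and not for \<open>a_inf\<close>, the excess itself may be slightly negative; the last summand, which is integrable
in time, compensates for this (\<open>gap_nonneg\<close>).\<close>

definition gap :: "real ^ ('n + 'm) \<Rightarrow> real ^ ('n + 'm) \<Rightarrow> real \<Rightarrow> real" where
  "gap y \<zeta> t = energy p E w (x t) - energy p E w y - h_inf \<bullet> free_part (x t - y)
             + norm \<zeta> * norm (a t - a_inf)"

lemma difference_decomp:
  assumes "c \<le> t" "y = free_part y + a_inf"
  shows "x t - y = free_part (x t - y) + (a t - a_inf)"
  unfolding free.diff add_diff_add[symmetric]
  by (intro arg_cong2[where f = minus] constr assms)

lemma gap_nonneg: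
  assumes "c \<le> t" and y: "y = free_part y + a_inf"
    and \<zeta>: "\<zeta> \<in> dphi p E w y" "free_part \<zeta> = free_part h_inf"
  shows "0 \<le> gap y \<zeta> t"
proof -
  define z where "z = free_part (x t - y)"
  define d where "d = a t - a_inf"
  have dec: "x t - y = z + d" using difference_decomp[OF assms(1) y] by (simp add: z_def d_def)
  have "\<zeta> \<bullet> z = h_inf \<bullet> z"
    unfolding z_def inner_free_part(1)[of \<zeta>] inner_free_part(1)[of h_inf] \<zeta>(2) ..
  moreover have "\<zeta> \<bullet> (x t - y) \<le> energy p E w (x t) - energy p E w y"
    using \<zeta>(1) by (simp add: mem_dphi_iff)
  moreover have "- (norm \<zeta> * norm d) \<le> \<zeta> \<bullet> d"
    using Cauchy_Schwarz_ineq2[of \<zeta> d] by linarith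
  ultimately show ?thesis
    unfolding gap_def z_def[symmetric] d_def[symmetric] using dec by (simp add: inner_add_right)
qed

text \<open>The derivative of \<open>\<parallel>z\<parallel>\<^sup>2\<close> plus twice the gap is at most \<open>1 + \<parallel>z\<parallel>\<^sup>2\<close> times a coefficient that is
integrable in time once \<open>R\<close> is chosen independent of \<open>t\<close>. The direction
\<open>z\<close> differs from \<open>x t - y\<close> by \<open>a t - a_inf\<close>, which costs a term \<open>\<parallel>\<eta>\<parallel> \<parallel>a t - a_inf\<parallel>\<close>; the quadratic growth
of the subgradients \<open>\<eta>\<close> is just what fits into the factor \<open>1 + \<parallel>z\<parallel>\<^sup>2\<close>.\<close>

lemma dissipation_inequality:
  assumes t: "c \<le> t" "t \<notin> N" and y: "y = free_part y + a_inf"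
    and C: "C \<ge> 0" "\<And>x \<eta>. \<eta> \<in> dphi p E w x \<Longrightarrow> norm \<eta> \<le> C * (1 + (norm x)\<^sup>2)"
    and R: "norm y + norm (a t - a_inf) \<le> R"
  defines "z \<equiv> free_part (x t - y)"
  shows "2 * (z \<bullet> free_part (x' t)) + 2 * gap y \<zeta> t
     \<le> (2 * norm (h t - h_inf) + 2 * (C * (2 + 2 * R\<^sup>2) + norm \<zeta>) * norm (a t - a_inf)) * (1 + (norm z)\<^sup>2)"
proof -
  define d where "d = a t - a_inf"
  define u where "u = (norm z)\<^sup>2"
  have u0: "u \<ge> 0" by (simp add: u_def)
  have dec: "x t - y = z + d" using difference_decomp[OF t(1) y] by (simp add: z_def d_def)
  obtain \<eta> where \<eta>: "\<eta> \<in> dphi p E w (x t)" "free_part (x' t) = free_part (h t - \<eta>)"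
    using flow[OF t] by blast
  have "z \<bullet> free_part (x' t) = z \<bullet> (h t - \<eta>)"
    unfolding \<eta>(2) z_def by (metis inner_free_part(2))
  also have "\<dots> = z \<bullet> (h t - h_inf) + h_inf \<bullet> z + \<eta> \<bullet> d + \<eta> \<bullet> (y - x t)"
  proof -
    have "y - x t = - (z + d)" using dec by (metis minus_diff_eq)
    then show ?thesis by (simp add: inner_diff_right inner_add_right inner_commute)
  qed
  also have "\<dots> \<le> norm z * norm (h t - h_inf) + h_inf \<bullet> z + norm \<eta> * norm d
                 + (energy p E w y - energy p E w (x t))"
    using norm_cauchy_schwarz[of z "h t - h_inf"] norm_cauchy_schwarz[of \<eta> d] \<eta>(1)
    unfolding mem_dphi_iff by (intro add_mono) auto
  finally have main: "z \<bullet> free_part (x' t) + gap y \<zeta> t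
      \<le> norm z * norm (h t - h_inf) + (norm \<eta> + norm \<zeta>) * norm d"
    by (simp add: gap_def z_def[symmetric] d_def[symmetric] distrib_right)
  have "2 * norm z \<le> 1 + u"
    using zero_le_power2[of "norm z - 1"] by (simp add: u_def power2_eq_square algebra_simps)
  then have "norm z \<le> 1 + u" using norm_ge_zero[of z] by linarith
  then have 1: "norm z * norm (h t - h_inf) \<le> (1 + u) * norm (h t - h_inf)"
    by (intro mult_right_mono) auto
  have "norm (x t) \<le> norm z + R"
  proof -
    have "x t = y + (z + d)" using dec by (metis add_diff_cancel_left' diff_add_cancel add.commute)
    then have "norm (x t) \<le> norm y + (norm z + norm d)"
      using norm_triangle_ineq[of y "z + d"] norm_triangle_ineq[of z d] by simp
    then show ?thesis using R by (simp add: d_def)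
  qed
  then have "(norm (x t))\<^sup>2 \<le> (norm z + R)\<^sup>2" by (intro power_mono) auto
  also have "\<dots> \<le> 2 * u + 2 * R\<^sup>2"
    using zero_le_power2[of "norm z - R"] by (simp add: u_def power2_eq_square algebra_simps)
  also have "\<dots> \<le> (2 + 2 * R\<^sup>2) * (1 + u) - 1"
  proof -
    have "(2 + 2 * R\<^sup>2) * (1 + u) = 2 + 2 * u + 2 * R\<^sup>2 + 2 * (R\<^sup>2 * u)" by (simp add: algebra_simps)
    moreover have "0 \<le> R\<^sup>2 * u" using u0 by simp
    ultimately show ?thesis by linarith
  qed
  finally have "1 + (norm (x t))\<^sup>2 \<le> (2 + 2 * R\<^sup>2) * (1 + u)" by linarith
  then have "norm \<eta> \<le> C * ((2 + 2 * R\<^sup>2) * (1 + u))"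
    using C(2)[OF \<eta>(1)] C(1) by (meson mult_left_mono order_trans)
  moreover have "norm \<zeta> \<le> norm \<zeta> * (1 + u)" using u0 by (simp add: distrib_left)
  ultimately have "norm \<eta> + norm \<zeta> \<le> (C * (2 + 2 * R\<^sup>2) + norm \<zeta>) * (1 + u)"
    by (simp add: distrib_right mult.assoc)
  then have 2: "(norm \<eta> + norm \<zeta>) * norm d \<le> (C * (2 + 2 * R\<^sup>2) + norm \<zeta>) * (1 + u) * norm d"
    by (intro mult_right_mono) auto
  have "2 * (z \<bullet> free_part (x' t)) + 2 * gap y \<zeta> t
     \<le> 2 * ((1 + u) * norm (h t - h_inf)) + 2 * ((C * (2 + 2 * R\<^sup>2) + norm \<zeta>) * (1 + u) * norm d)"
    using main 1 2 by linarith
  also have "\<dots> = (2 * norm (h t - h_inf) + 2 * (C * (2 + 2 * R\<^sup>2) + norm \<zeta>) * norm d) * (1 + u)"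
    by algebra
  finally show ?thesis by (simp add: d_def u_def)
qed

lemma dissipation:
  assumes y: "y = free_part y + a_inf"
    and \<zeta>: "\<zeta> \<in> dphi p E w y" "free_part \<zeta> = free_part h_inf"
  shows "\<exists>l. ((\<lambda>t. (norm (free_part (x t - y)))\<^sup>2) \<longlongrightarrow> l) at_top"
    and "\<exists>B. \<forall>t\<ge>c. norm (x t) \<le> B"
    and "e > 0 \<Longrightarrow> \<exists>t\<ge>T. gap y \<zeta> t < e"
proof -
  obtain C where C: "C \<ge> 0" "\<And>x \<eta>. \<eta> \<in> dphi p E w x \<Longrightarrow> norm \<eta> \<le> C * (1 + (norm x)\<^sup>2)"
    using dphi_quadratic_growth[OF G p] by blast
  have cd: "continuous_on {c..} (\<lambda>t. a t - a_inf)" by (intro continuous_intros cont)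
  obtain D where D: "D \<ge> 0" "\<And>t. c \<le> t \<Longrightarrow> norm (a t - a_inf) \<le> D"
  proof (rule bounded_on_half_line[OF cd])
    show "((\<lambda>t. a t - a_inf) \<longlongrightarrow> a_inf - a_inf) at_top" by (intro tendsto_intros a_lim)
  qed blast
  define R where "R = norm y + D"
  define z where "z t = free_part (x t - y)" for t
  define u where "u t = (norm (z t))\<^sup>2" for t
  define k where "k t = 2 * norm (h t - h_inf) + 2 * (C * (2 + 2 * R\<^sup>2) + norm \<zeta>) * norm (a t - a_inf)" for t
  have cz: "continuous_on {c..} z"
    unfolding z_def by (intro free.continuous_on continuous_intros cont)
  have cu: "continuous_on {c..} u" unfolding u_def by (intro continuous_intros cz)
  have ck: "continuous_on {c..} k" unfolding k_def by (intro continuous_intros cont)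
  have cg: "continuous_on {c..} (\<lambda>t. 2 * gap y \<zeta> t)"
    unfolding gap_def z_def[symmetric]
    by (intro continuous_intros cont cz continuous_on_compose2[OF continuous_on_energy[OF G p(1)] cont(1)]) auto
  have kint: "k absolutely_integrable_on {c..}"
    unfolding k_def
    by (intro set_integral_add(1) absolutely_integrable_norm[unfolded o_def, OF h_int]
          absolutely_integrable_norm[unfolded o_def, OF a_int] set_integrable_mult_right impI)
  have k0: "0 \<le> k t" for t unfolding k_def using C(1) by simp
  have ineq: "u t - u s + integral {s..t} (\<lambda>\<tau>. 2 * gap y \<zeta> \<tau>) \<le> integral {s..t} (\<lambda>\<tau>. k \<tau> * (1 + u \<tau>))"
    if st: "c \<le> s" "s \<le> t" for s t
  proof -
    have sub: "{s..t} \<subseteq> {c..}" using st by auto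
    note cs = continuous_on_subset[OF _ sub]
    have U: "((\<lambda>\<tau>. 2 * (z \<tau> \<bullet> free_part (x' \<tau>))) has_integral (u t - u s)) {s..t}"
      unfolding u_def
    proof (rule norm_square_has_integral[OF st(2) cs[OF cz]])
      show "(\<lambda>\<tau>. free_part (x' \<tau>)) absolutely_integrable_on {s..t}"
        using absolutely_integrable_linear[OF x'_int[OF st] bounded_linear_free_part] by (simp add: o_def)
      fix v v' assume "s \<le> v" "v \<le> v'" "v' \<le> t"
      then have "((free_part \<circ> x') has_integral free_part (x v' - x v)) {v..v'}"
        using st by (intro has_integral_linear[OF _ bounded_linear_free_part] ftc) auto
      then show "((\<lambda>\<tau>. free_part (x' \<tau>)) has_integral z v' - z v) {v..v'}"
        by (simp add: o_def z_def free.diff)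
    qed
    have gI: "(\<lambda>\<tau>. 2 * gap y \<zeta> \<tau>) integrable_on {s..t}"
      by (rule integrable_continuous_real[OF cs[OF cg]])
    have kI: "(\<lambda>\<tau>. k \<tau> * (1 + u \<tau>)) integrable_on {s..t}"
      by (intro integrable_continuous_real continuous_intros cs[OF ck] cs[OF cu])
    show ?thesis
    proof (rule has_integral_le_negligible[OF has_integral_add[OF U integrable_integral[OF gI]]
          integrable_integral[OF kI] N])
      fix \<tau> assume \<tau>: "\<tau> \<in> {s..t} - N"
      then have "c \<le> \<tau>" "\<tau> \<notin> N" using st by auto
      then show "2 * (z \<tau> \<bullet> free_part (x' \<tau>)) + 2 * gap y \<zeta> \<tau> \<le> k \<tau> * (1 + u \<tau>)"
        unfolding z_def u_def k_def
        by (intro dissipation_inequality y C) (use D in \<open>auto simp: R_def\<close>)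
    qed
  qed
  have g0: "0 \<le> 2 * gap y \<zeta> t" if "c \<le> t" for t using gap_nonneg[OF that y \<zeta>] by simp
  note result = perturbed_dissipation[OF cu _ cg g0 ck k0 kint ineq, unfolded u_def z_def]
  show "\<exists>l. ((\<lambda>t. (norm (free_part (x t - y)))\<^sup>2) \<longlongrightarrow> l) at_top"
    by (rule result(1)) auto
  show "\<exists>t\<ge>T. gap y \<zeta> t < e" if "e > 0"
    using result(3)[of "2 * e" T] that by auto
  obtain B where B: "\<And>t. t \<ge> c \<Longrightarrow> (norm (free_part (x t - y)))\<^sup>2 \<le> B"
    using result(2) by auto
  have "norm (x t) \<le> norm y + sqrt B + D" if "t \<ge> c" for t
  proof -
    have "norm (x t) \<le> norm y + norm (x t - y)" using norm_triangle_ineq[of y "x t - y"] by simp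
    also have "norm (x t - y) \<le> norm (free_part (x t - y)) + norm (a t - a_inf)"
      using norm_triangle_ineq difference_decomp[OF that y] by metis
    finally show ?thesis using real_le_rsqrt[OF B[OF that]] D(2)[OF that] by linarith
  qed
  then show "\<exists>B. \<forall>t\<ge>c. norm (x t) \<le> B" by blast
qed

text \<open>The limit inherits the subgradient \<open>\<zeta>\<close> of the given equilibrium, so no sum rule for
subdifferentials is needed to recognise it as an equilibrium.\<close>

lemma converges_to_equilibrium:
  assumes y: "y = free_part y + a_inf"
    and \<zeta>: "\<zeta> \<in> dphi p E w y" "free_part \<zeta> = free_part h_inf"
  obtains xs where "(x \<longlongrightarrow> xs) at_top" "xs = free_part xs + a_inf" "\<zeta> \<in> dphi p E w xs"
proof -
  note diss = dissipation[OF y \<zeta>]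
  have "\<exists>t\<ge>max c (real n). gap y \<zeta> t < inverse (real (Suc n))" for n
    by (rule diss(3)) simp
  then obtain T where T: "\<And>n. T n \<ge> max c (real n)" "\<And>n. gap y \<zeta> (T n) < inverse (real (Suc n))"
    by metis
  have Tc: "T n \<ge> c" for n using T(1)[of n] by simp
  have Ttop: "filterlim T at_top sequentially"
    by (rule filterlim_at_top_mono[OF filterlim_real_sequentially]) (use T(1) in auto)
  have gap0: "(\<lambda>n. gap y \<zeta> (T n)) \<longlonglongrightarrow> 0"
    by (rule tendsto_sandwich[OF _ _ tendsto_const LIMSEQ_inverse_real_of_nat])
       (use T(2) gap_nonneg[OF Tc y \<zeta>] in \<open>auto intro!: always_eventually less_imp_le\<close>)
  obtain B where "\<And>t. t \<ge> c \<Longrightarrow> norm (x t) \<le> B" using diss(2) by blast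
  then have "bounded (range (\<lambda>n. x (T n)))" using Tc by (auto simp: bounded_iff)
  then obtain xs r where r: "strict_mono (r :: nat \<Rightarrow> nat)" "((\<lambda>n. x (T n)) \<circ> r) \<longlonglongrightarrow> xs"
    using bounded_imp_convergent_subsequence by blast
  define S where "S = (\<lambda>n. T (r n))"
  have Stop: "filterlim S at_top sequentially"
    unfolding S_def by (rule filterlim_compose[OF Ttop filterlim_subseq[OF r(1)]])
  have Sc: "S n \<ge> c" for n by (simp add: S_def Tc)
  have xS: "(\<lambda>n. x (S n)) \<longlonglongrightarrow> xs" using r(2) by (simp add: S_def o_def)
  have aS: "(\<lambda>n. a (S n)) \<longlonglongrightarrow> a_inf" by (rule filterlim_compose[OF a_lim Stop])
  have fxs: "xs = free_part xs + a_inf"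
  proof (rule LIMSEQ_unique[OF xS])
    have "(\<lambda>n. free_part (x (S n)) + a (S n)) \<longlonglongrightarrow> free_part xs + a_inf"
      by (intro tendsto_intros free.tendsto xS aS)
    then show "(\<lambda>n. x (S n)) \<longlonglongrightarrow> free_part xs + a_inf" using constr[OF Sc] by simp
  qed
  have "(\<lambda>n. gap y \<zeta> (S n)) \<longlonglongrightarrow>
      energy p E w xs - energy p E w y - h_inf \<bullet> free_part (xs - y) + norm \<zeta> * norm (a_inf - a_inf)"
    unfolding gap_def
    by (intro tendsto_intros free.tendsto xS aS
          continuous_on_tendsto_compose[OF continuous_on_energy[OF G p(1)] xS]) auto
  moreover have "(\<lambda>n. gap y \<zeta> (S n)) \<longlonglongrightarrow> 0"
    using LIMSEQ_subseq_LIMSEQ[OF gap0 r(1)] by (simp add: S_def o_def)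
  ultimately have "energy p E w xs - energy p E w y - h_inf \<bullet> free_part (xs - y)
      + norm \<zeta> * norm (a_inf - a_inf) = 0"
    by (rule LIMSEQ_unique)
  then have eq: "energy p E w xs - energy p E w y = h_inf \<bullet> free_part (xs - y)" by simp
  \<comment> \<open>the gap closes along \<open>S\<close>, so the supporting affine function of the energy given by \<open>\<zeta>\<close> at \<open>y\<close> also
      touches at \<open>xs\<close>\<close>
  have \<zeta>xs: "\<zeta> \<in> dphi p E w xs"
    unfolding mem_dphi_iff
  proof
    fix v
    have "free_part (xs - y) = xs - y" using fxs y by (metis add_diff_cancel_right free.diff)
    then have "\<zeta> \<bullet> (xs - y) = energy p E w xs - energy p E w y"
      unfolding eq by (metis inner_free_part(1) \<zeta>(2))
    moreover have "\<zeta> \<bullet> (v - y) \<le> energy p E w v - energy p E w y"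
      using \<zeta>(1) by (simp add: mem_dphi_iff)
    moreover have "\<zeta> \<bullet> (v - xs) = \<zeta> \<bullet> (v - y) - \<zeta> \<bullet> (xs - y)" by (simp add: inner_diff_right)
    ultimately show "\<zeta> \<bullet> (v - xs) \<le> energy p E w v - energy p E w xs" by simp
  qed
  \<comment> \<open>hence the distance to \<open>xs\<close> converges too, and its limit is \<open>0\<close> since it is so along \<open>S\<close>\<close>
  obtain l where l: "((\<lambda>t. (norm (free_part (x t - xs)))\<^sup>2) \<longlongrightarrow> l) at_top"
    using dissipation(1)[OF fxs \<zeta>xs \<zeta>(2)] by blast
  have "(\<lambda>n. (norm (free_part (x (S n) - xs)))\<^sup>2) \<longlonglongrightarrow> l"
    by (rule filterlim_compose[OF l Stop])
  moreover have "(\<lambda>n. (norm (free_part (x (S n) - xs)))\<^sup>2) \<longlonglongrightarrow> (norm (free_part (xs - xs)))\<^sup>2"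
    by (intro tendsto_intros free.tendsto xS)
  ultimately have "l = (norm (free_part (xs - xs)))\<^sup>2" by (rule LIMSEQ_unique)
  then have "l = 0" by (simp add: free.zero)
  with l have "((\<lambda>t. sqrt ((norm (free_part (x t - xs)))\<^sup>2)) \<longlongrightarrow> sqrt 0) at_top"
    by (intro tendsto_real_sqrt) simp
  then have z0: "((\<lambda>t. free_part (x t - xs)) \<longlongrightarrow> 0) at_top"
    by (simp add: tendsto_norm_zero_iff)
  have "((\<lambda>t. free_part (x t - xs) + (a t - a_inf) + xs) \<longlongrightarrow> 0 + (a_inf - a_inf) + xs) at_top"
    by (intro tendsto_intros z0 a_lim)
  moreover have "\<forall>\<^sub>F t in at_top. free_part (x t - xs) + (a t - a_inf) + xs = x t"
    using eventually_ge_at_top[of c]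
    by eventually_elim (metis difference_decomp[OF _ fxs] diff_add_cancel)
  ultimately have "(x \<longlongrightarrow> 0 + (a_inf - a_inf) + xs) at_top" by (rule Lim_transform_eventually)
  then have "(x \<longlongrightarrow> xs) at_top" by simp
  then show thesis using that fxs \<zeta>xs by blast
qed

end

lemma AE_halfline_negligible:
  assumes "AE t in lebesgue_on {c<..}. P (t::real)"
  obtains N where "negligible N" "\<And>t. c < t \<Longrightarrow> t \<notin> N \<Longrightarrow> P t"
proof -
  have "AE t in lebesgue. t \<in> {c<..} \<longrightarrow> P t"
    using assms by (subst (asm) AE_restrict_space_iff) auto
  then obtain N where "N \<in> null_sets lebesgue" "{t \<in> space lebesgue. \<not> (t \<in> {c<..} \<longrightarrow> P t)} \<subseteq> N"
    unfolding eventually_ae_filter by blast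
  then show ?thesis using that[of N] by (auto simp: negligible_iff_null_sets)
qed

lemma continuous_zero_off_negligible:
  fixes f :: "real \<Rightarrow> real"
  assumes "continuous_on S f" "open S" "negligible N" "\<And>t. t \<in> S \<Longrightarrow> t \<notin> N \<Longrightarrow> f t = 0" "t \<in> S"
  shows "f t = 0"
proof (rule ccontr)
  assume "f t \<noteq> 0"
  have "open (S \<inter> f -` (- {0}))" by (rule continuous_open_preimage) (use assms in auto)
  moreover have "S \<inter> f -` (- {0}) \<subseteq> N" using assms(4) by auto
  ultimately show False
    using open_not_negligible[of "S \<inter> f -` (- {0})"] negligible_subset[OF assms(3)] \<open>f t \<noteq> 0\<close> assms(5) by auto
qed

theorem theorem5p4:
  fixes E :: "('n::finite + 'm::finite) set set"
    and w :: "('n + 'm) set \<Rightarrow> real"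
    and p :: real
    and a a' h h' x :: "real \<Rightarrow> real ^ ('n + 'm)"
    and a_inf h_inf x0 :: "real ^ ('n + 'm)"
  assumes "hypergraph E w" and "connected_hypergraph E"
    and "1 \<le> p" and "p < 3"
    and "\<And>t i. t \<ge> 0 \<Longrightarrow> a t $ Inl i = 0"
    and "W12_loc a" and "weak_derivative_on {0<..} a a'"
    and "L2_loc h" and "continuous_on {0..} h" and "weak_derivative_on {0<..} h h'"
    and "a' absolutely_integrable_on {0<..}" and "h' absolutely_integrable_on {0<..}"
    and "a_inf = Lim at_top a" and "h_inf = Lim at_top h"
    and "L2_on {0<..} a'"
    and "h_inf \<in> (\<Union>y. dphi p E w y + dI a_inf y)"
    and "(\<lambda>t. a t - a_inf) absolutely_integrable_on {0<..}"
    and "(\<lambda>t. h t - h_inf) absolutely_integrable_on {0<..}"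
    and "L2_on {0<..} (\<lambda>t. h t - h_inf)"
    and "x0 \<in> constraint_set (a 0)"
    and "global_solution p E w a h x0 x"
  shows "(\<exists>!x_inf. (x \<longlongrightarrow> x_inf) at_top) \<and>
         h_inf \<in> dphi p E w (Lim at_top x) + dI a_inf (Lim at_top x)"
proof -
  have cont_a: "continuous_on {0..} a" using assms(6) by (simp add: W12_loc_def)
  have cont_x: "continuous_on {0..} x" using assms(21) by (simp add: global_solution_def W12_loc_def)
  obtain x' where x': "weak_derivative_on {0<..} x x'"
    and AE: "AE t in lebesgue_on {0<..}.
           \<exists>\<eta>\<in>dphi p E w (x t). \<exists>\<xi>\<in>dI (a t) (x t). x' t + \<eta> + \<xi> = h t"
    using assms(21) by (auto simp: global_solution_def)
  obtain N where N: "negligible N" "\<And>t. 0 < t \<Longrightarrow> t \<notin> N \<Longrightarrow>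
           \<exists>\<eta>\<in>dphi p E w (x t). \<exists>\<xi>\<in>dI (a t) (x t). x' t + \<eta> + \<xi> = h t"
    using AE_halfline_negligible[OF AE] by blast
  have a0: "free_part (a t) = 0" if "t \<ge> 0" for t
    using assms(5)[OF that] by (simp add: vec_eq_sum_iff)
  have x_constr: "x t = free_part (x t) + a t" if "1 \<le> t" for t
  proof -
    have "x t $ Inr j - a t $ Inr j = 0" for j
    proof (rule continuous_zero_off_negligible[where f = "\<lambda>t. x t $ Inr j - a t $ Inr j",
          OF _ open_greaterThan[of 0] N(1)])
      show "continuous_on {0<..} (\<lambda>t. x t $ Inr j - a t $ Inr j)"
        by (intro continuous_intros continuous_on_subset[OF cont_x] continuous_on_subset[OF cont_a]) auto
      show "x t $ Inr j - a t $ Inr j = 0" if "t \<in> {0<..}" "t \<notin> N" for t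
        using N(2)[of t] that by (auto simp: mem_dI_iff constraint_set_def)
      show "t \<in> {0<..}" using that by simp
    qed
    then show ?thesis using that
      by (subst constraint_set_iff[symmetric]) (auto simp: a0 constraint_set_def)
  qed
  have flow: "\<exists>\<eta>\<in>dphi p E w (x t). free_part (x' t) = free_part (h t - \<eta>)" if "1 \<le> t" "t \<notin> N" for t
  proof -
    have "0 < t" using that by simp
    from N(2)[OF this \<open>t \<notin> N\<close>]
    obtain \<eta> \<xi> where \<eta>: "\<eta> \<in> dphi p E w (x t)" "\<xi> \<in> dI (a t) (x t)" "x' t + \<eta> + \<xi> = h t"
      by blast
    have "h t - \<eta> = x' t + \<xi>" using \<eta>(3) by (simp add: algebra_simps)
    then have "free_part (h t - \<eta>) = free_part (x' t) + free_part \<xi>"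
      by (simp add: bounded_linear.linear bounded_linear_free_part linear_add)
    then have "free_part (x' t) = free_part (h t - \<eta>)" using \<eta>(2) by (simp add: mem_dI_iff)
    then show ?thesis using \<eta>(1) by blast
  qed
  have x'_int: "x' absolutely_integrable_on {s..t}" if "1 \<le> s" for s t
  proof -
    have "compact {s..t}" "{s..t} \<subseteq> {0<..}" using that by auto
    then show ?thesis using x' unfolding weak_derivative_on_def by blast
  qed
  have x_ftc: "(x' has_integral (x t - x s)) {s..t}" if "1 \<le> s" "s \<le> t" for s t
    using that by (intro weak_derivative_has_integral[OF x' continuous_on_subset[OF cont_x]]) auto
  have "\<exists>l. (a \<longlongrightarrow> l) at_top"
  proof (rule convergent_at_top_of_integrable_derivative)
    show "a' absolutely_integrable_on {1..}"
      using assms(11) by (rule set_integrable_subset) auto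
    show "(a' has_integral (a t - a 1)) {1..t}" if "1 \<le> t" for t
      using that by (intro weak_derivative_has_integral[OF assms(7) continuous_on_subset[OF cont_a]]) auto
  qed
  then have a_lim: "(a \<longlongrightarrow> a_inf) at_top"
    unfolding assms(13) by (auto simp: tendsto_Lim)
  have a_inf0: "free_part a_inf = 0"
  proof (rule tendsto_unique[OF trivial_limit_at_top_linorder])
    show "((\<lambda>t. free_part (a t)) \<longlongrightarrow> free_part a_inf) at_top"
      by (rule bounded_linear.tendsto[OF bounded_linear_free_part a_lim])
    show "((\<lambda>t. free_part (a t)) \<longlongrightarrow> 0) at_top"
      by (rule tendsto_eventually) (use eventually_ge_at_top[of 0] in \<open>eventually_elim, simp add: a0\<close>)
  qed
  interpret constrained_flow p E w a h x x' a_inf h_inf N 1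
  proof unfold_locales
    show "continuous_on {1..} x" "continuous_on {1..} a" "continuous_on {1..} h"
      by (rule continuous_on_subset[OF cont_x] continuous_on_subset[OF cont_a]
          continuous_on_subset[OF assms(9)]; simp)+
    show "(\<lambda>t. a t - a_inf) absolutely_integrable_on {1..}"
      using assms(17) by (rule set_integrable_subset) auto
    show "(\<lambda>t. h t - h_inf) absolutely_integrable_on {1..}"
      using assms(18) by (rule set_integrable_subset) auto
  qed (use assms(1,3,4) N(1) flow x_constr x'_int x_ftc a_lim in auto)
  obtain y \<zeta> \<xi> where y: "\<zeta> \<in> dphi p E w y" "\<xi> \<in> dI a_inf y" "h_inf = \<zeta> + \<xi>"
    using assms(16) by (auto elim!: set_plus_elim)
  have y_eq: "y = free_part y + a_inf" using y(2) a_inf0 by (simp add: mem_dI_iff constraint_set_iff[symmetric])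
  have \<zeta>: "free_part \<zeta> = free_part h_inf"
    using y(2,3) by (simp add: mem_dI_iff bounded_linear.linear bounded_linear_free_part linear_add)
  obtain xs where xs: "(x \<longlongrightarrow> xs) at_top" "xs = free_part xs + a_inf" "\<zeta> \<in> dphi p E w xs"
    using converges_to_equilibrium[OF y_eq y(1) \<zeta>] by blast
  have Lim: "Lim at_top x = xs" by (rule tendsto_Lim[OF trivial_limit_at_top_linorder xs(1)])
  have "\<xi> \<in> dI a_inf xs"
    using xs(2) y(2) a_inf0 by (simp add: mem_dI_iff constraint_set_iff)
  then have "h_inf \<in> dphi p E w xs + dI a_inf xs"
    unfolding y(3) using xs(3) by (rule set_plus_intro[rotated])
  moreover have "\<exists>!x_inf. (x \<longlongrightarrow> x_inf) at_top"
    using xs(1) tendsto_unique[OF trivial_limit_at_top_linorder] by blast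
  ultimately show ?thesis unfolding Lim by blast
qed

end
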